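(* Let $X\in M(n,\mathbb{C})$ with $\|X\|=1$. Then $$\sum_{i=1}^{2k}\lambda_i(T_X)\le 2k+1+2\sqrt{k},\qquad k=1,\dots,\left\lfloor\frac{n^2}{2}\right\rfloor.$$
   Context: $M(n,\mathbb{C})$ is the space of complex $n\times n$ matrices, $X^*$ is the conjugate transpose, $\|X\|=\sqrt{\operatorname{Tr}XX^*}$ is the Frobenius norm, and $[X,Y]=XY-YX$. $T_X$ is the linear map on $M(n,\mathbb{C})$ given by $T_X(Y)=[X^*,[X,Y]]$; it is self-adjoint and positive semi-definite for $\langle Y,Z\rangle=\operatorname{Tr}(YZ^* )$, and $\lambda_1(T_X)\ge\lambda_2(T_X)\ge\cdots\ge\lambda_{n^2}(T_X)$ are its eigenvalues counted with multiplicity. *)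

theory Defs
  imports Complex_Main "HOL-Computational_Algebra.Fundamental_Theorem_Algebra"
    "Jordan_Normal_Form.Schur_Decomposition"
begin

definition mat_trace :: "complex mat \<Rightarrow> complex" where
  "mat_trace A = (\<Sum>i<dim_row A. A $$ (i, i))"

definition frobenius_norm :: "complex mat \<Rightarrow> real" where
  "frobenius_norm A = sqrt (Re (mat_trace (A * mat_adjoint A)))"

definition commutator :: "complex mat \<Rightarrow> complex mat \<Rightarrow> complex mat" where
  "commutator A B = A * B - B * A"

definition T_map :: "complex mat \<Rightarrow> complex mat \<Rightarrow> complex mat" where
  "T_map X Y = commutator (mat_adjoint X) (commutator X Y)"

definition matrix_unit :: "nat \<Rightarrow> nat \<Rightarrow> nat \<Rightarrow> complex mat" where
  "matrix_unit n i j = mat n n (\<lambda>p. if p = (i, j) then 1 else 0)"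

text \<open>Coordinates with respect to the matrix units, ordered row by row: the index \<open>p < n * n\<close>
  stands for the position \<open>(p div n, p mod n)\<close>. \<open>map_matrix n F\<close> is the matrix of a linear map
  \<open>F\<close> on the \<open>n\<close> by \<open>n\<close> matrices in this basis; see \<open>map_matrix_T_map\<close> below.\<close>

definition mat_coords :: "nat \<Rightarrow> complex mat \<Rightarrow> complex vec" where
  "mat_coords n Y = vec (n * n) (\<lambda>p. Y $$ (p div n, p mod n))"

definition map_matrix :: "nat \<Rightarrow> (complex mat \<Rightarrow> complex mat) \<Rightarrow> complex mat" where
  "map_matrix n F =
     mat (n * n) (n * n) (\<lambda>(p, q). F (matrix_unit n (q div n) (q mod n)) $$ (p div n, p mod n))"

text \<open>\<open>eig_desc n F i\<close> is the \<open>i\<close>-th largest eigenvalue (\<open>i = 1, \<dots>, n * n\<close>), counted with its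
  multiplicity as a root of the characteristic polynomial, of a linear map \<open>F\<close> all of whose
  eigenvalues are real. For \<open>F = T_map X\<close> there are exactly \<open>n * n\<close> of them and taking real
  parts changes nothing; see \<open>size_eigenvalues_T_map\<close> and \<open>eigenvalue_T_map_nonneg\<close> below.\<close>

definition eig_desc :: "nat \<Rightarrow> (complex mat \<Rightarrow> complex mat) \<Rightarrow> nat \<Rightarrow> real" where
  "eig_desc n F i =
     rev (sorted_list_of_multiset (image_mset Re (proots (char_poly (map_matrix n F))))) ! (i - 1)"

text \<open>Entry at \<open>(a, b)\<close>, \<open>(c, d)\<close> of the matrix of \<open>Y \<mapsto> [A, Y]\<close>; only used in the proofs below.\<close>

definition comm_coef :: "complex mat \<Rightarrow> nat \<Rightarrow> nat \<Rightarrow> nat \<Rightarrow> nat \<Rightarrow> complex" where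
  "comm_coef A a b c d = (if d = b then A $$ (a, c) else 0) - (if c = a then A $$ (d, b) else 0)"

lemma commutator_carrier:
  assumes "A \<in> carrier_mat n n" "Y \<in> carrier_mat n n"
  shows "commutator A Y \<in> carrier_mat n n"
  using assms unfolding commutator_def by auto

lemma index_less:
  fixes i j n :: nat
  assumes "i < n" "j < n"
  shows "i * n + j < n * n"
proof -
  have "i * n + j < Suc i * n" using assms by simp
  also have "\<dots> \<le> n * n" using assms by (intro mult_le_mono1) simp
  finally show ?thesis .
qed

lemma mat_adjoint_index:
  assumes "A \<in> carrier_mat n m" "i < m" "j < n"
  shows "mat_adjoint A $$ (i, j) = cnj (A $$ (j, i))"
  using assms by (auto simp: mat_adjoint_def mat_of_rows_def)

lemma mat_adjoint_carrier:
  assumes "A \<in> carrier_mat n m"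
  shows "mat_adjoint A \<in> carrier_mat m n"
  using assms by (auto simp: mat_adjoint_def mat_of_rows_def)

lemma commutator_index:
  assumes A: "A \<in> carrier_mat n n" and Y: "Y \<in> carrier_mat n n" and ab: "a < n" "b < n"
  shows "commutator A Y $$ (a, b) = (\<Sum>c<n. \<Sum>d<n. comm_coef A a b c d * Y $$ (c, d))"
proof -
  have 1: "(A * Y) $$ (a, b) = (\<Sum>c<n. A $$ (a, c) * Y $$ (c, b))"
    using A Y ab by (auto simp: scalar_prod_def atLeast0LessThan)
  have 2: "(Y * A) $$ (a, b) = (\<Sum>d<n. Y $$ (a, d) * A $$ (d, b))"
    using A Y ab by (auto simp: scalar_prod_def atLeast0LessThan)
  have "(\<Sum>c<n. \<Sum>d<n. comm_coef A a b c d * Y $$ (c, d))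
     = (\<Sum>c<n. \<Sum>d<n. (if d = b then A $$ (a, c) * Y $$ (c, d) else 0)
          - (if c = a then A $$ (d, b) * Y $$ (c, d) else 0))"
    by (intro sum.cong refl) (simp add: comm_coef_def algebra_simps)
  also have "\<dots> = (\<Sum>c<n. \<Sum>d<n. if d = b then A $$ (a, c) * Y $$ (c, d) else 0)
       - (\<Sum>c<n. \<Sum>d<n. if c = a then A $$ (d, b) * Y $$ (c, d) else 0)"
    by (simp add: sum_subtractf)
  also have "(\<Sum>c<n. \<Sum>d<n. if c = a then A $$ (d, b) * Y $$ (c, d) else 0)
       = (\<Sum>c<n. if c = a then \<Sum>d<n. A $$ (d, b) * Y $$ (c, d) else 0)"
    by (intro sum.cong refl) simp
  also have "(\<Sum>c<n. \<Sum>d<n. if d = b then A $$ (a, c) * Y $$ (c, d) else 0) - \<dots>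
       = (A * Y) $$ (a, b) - (Y * A) $$ (a, b)"
    unfolding 1 2 using ab by (simp add: mult.commute)
  also have "\<dots> = commutator A Y $$ (a, b)"
    using A Y ab by (simp add: commutator_def)
  finally show ?thesis by simp
qed

lemma T_map_carrier:
  assumes "X \<in> carrier_mat n n" "Y \<in> carrier_mat n n"
  shows "T_map X Y \<in> carrier_mat n n"
  unfolding T_map_def using assms by (intro commutator_carrier mat_adjoint_carrier)

lemma sum_swap4:
  fixes h :: "nat \<Rightarrow> nat \<Rightarrow> nat \<Rightarrow> nat \<Rightarrow> complex"
  shows "(\<Sum>a\<in>A. \<Sum>b\<in>B. \<Sum>c\<in>C. \<Sum>d\<in>D. h a b c d) = (\<Sum>c\<in>C. \<Sum>d\<in>D. \<Sum>a\<in>A. \<Sum>b\<in>B. h a b c d)"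
proof -
  have "(\<Sum>a\<in>A. \<Sum>b\<in>B. \<Sum>c\<in>C. \<Sum>d\<in>D. h a b c d) = (\<Sum>a\<in>A. \<Sum>c\<in>C. \<Sum>b\<in>B. \<Sum>d\<in>D. h a b c d)"
    by (rule sum.cong[OF refl], rule sum.swap)
  also have "\<dots> = (\<Sum>c\<in>C. \<Sum>a\<in>A. \<Sum>d\<in>D. \<Sum>b\<in>B. h a b c d)"
    by (subst sum.swap, rule sum.cong[OF refl], rule sum.cong[OF refl], rule sum.swap)
  also have "\<dots> = (\<Sum>c\<in>C. \<Sum>d\<in>D. \<Sum>a\<in>A. \<Sum>b\<in>B. h a b c d)"
    by (rule sum.cong[OF refl], rule sum.swap)
  finally show ?thesis .
qed

lemma T_map_matrix_unit_expansion:
  assumes X: "X \<in> carrier_mat n n" and Y: "Y \<in> carrier_mat n n" and ab: "a < n" "b < n"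
  shows "T_map X Y $$ (a, b) =
    (\<Sum>c<n. \<Sum>d<n. T_map X (matrix_unit n c d) $$ (a, b) * Y $$ (c, d))"
proof -
  define K where "K c d = (\<Sum>e<n. \<Sum>f<n. comm_coef (mat_adjoint X) a b e f * comm_coef X e f c d)"
    for c d
  have K: "T_map X Z $$ (a, b) = (\<Sum>c<n. \<Sum>d<n. K c d * Z $$ (c, d))"
    if Z: "Z \<in> carrier_mat n n" for Z
  proof -
    have "T_map X Z $$ (a, b) = (\<Sum>e<n. \<Sum>f<n. comm_coef (mat_adjoint X) a b e f *
       (\<Sum>c<n. \<Sum>d<n. comm_coef X e f c d * Z $$ (c, d)))"
      unfolding T_map_def
      by (subst commutator_index[OF mat_adjoint_carrier[OF X] commutator_carrier[OF X Z] ab])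
        (intro sum.cong refl, simp add: commutator_index[OF X Z])
    also have "\<dots> = (\<Sum>e<n. \<Sum>f<n. \<Sum>c<n. \<Sum>d<n.
        comm_coef (mat_adjoint X) a b e f * comm_coef X e f c d * Z $$ (c, d))"
      by (simp add: sum_distrib_left mult.assoc)
    also have "\<dots> = (\<Sum>c<n. \<Sum>d<n. \<Sum>e<n. \<Sum>f<n.
        comm_coef (mat_adjoint X) a b e f * comm_coef X e f c d * Z $$ (c, d))"
      by (rule sum_swap4)
    finally show ?thesis by (simp add: K_def sum_distrib_right)
  qed
  have "T_map X (matrix_unit n c d) $$ (a, b) = K c d" if cd: "c < n" "d < n" for c d
  proof -
    have "T_map X (matrix_unit n c d) $$ (a, b)
      = (\<Sum>c'<n. \<Sum>d'<n. K c' d' * matrix_unit n c d $$ (c', d'))"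
      by (rule K) (simp add: matrix_unit_def)
    also have "\<dots> = (\<Sum>c'<n. if c' = c then \<Sum>d'<n. if d' = d then K c' d' else 0 else 0)"
      using cd by (intro sum.cong refl) (auto simp: matrix_unit_def if_distrib cong: if_cong)
    also have "\<dots> = K c d" using cd by simp
    finally show ?thesis .
  qed
  then show ?thesis by (simp add: K[OF Y])
qed

lemma sum_div_mod:
  fixes g :: "nat \<Rightarrow> nat \<Rightarrow> complex"
  shows "(\<Sum>q<n*n. g (q div n) (q mod n)) = (\<Sum>c<n. \<Sum>d<n. g c d)"
proof -
  have "(\<Sum>q<n*n. g (q div n) (q mod n)) = (\<Sum>(c, d)\<in>{..<n} \<times> {..<n}. g c d)"
  proof (rule sum.reindex_bij_witness[of _ "\<lambda>(c, d). c * n + d" "\<lambda>q. (q div n, q mod n)"])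
    fix q assume "q \<in> {..<n * n}"
    then have q: "q < n * n" by simp
    then have "n > 0" by (cases n) auto
    with q show "(q div n, q mod n) \<in> {..<n} \<times> {..<n}"
      by (simp add: less_mult_imp_div_less)
  qed (auto simp: index_less)
  then show ?thesis by (simp add: sum.cartesian_product)
qed

lemma map_matrix_T_map:
  assumes X: "X \<in> carrier_mat n n" and Y: "Y \<in> carrier_mat n n"
  shows "map_matrix n (T_map X) *\<^sub>v mat_coords n Y = mat_coords n (T_map X Y)"
proof (rule eq_vecI)
  fix p assume "p < dim_vec (mat_coords n (T_map X Y))"
  then have p: "p < n * n" by (simp add: mat_coords_def)
  then have n: "n > 0" by (cases n) auto
  have ab: "p div n < n" "p mod n < n"
    using p n by (auto simp: less_mult_imp_div_less)
  have "(map_matrix n (T_map X) *\<^sub>v mat_coords n Y) $ p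
    = (\<Sum>q<n*n. T_map X (matrix_unit n (q div n) (q mod n)) $$ (p div n, p mod n) *
          Y $$ (q div n, q mod n))"
    using p by (simp add: map_matrix_def mat_coords_def scalar_prod_def atLeast0LessThan)
  also have "\<dots> = (\<Sum>c<n. \<Sum>d<n. T_map X (matrix_unit n c d) $$ (p div n, p mod n) * Y $$ (c, d))"
    by (rule sum_div_mod[where g = "\<lambda>c d. T_map X (matrix_unit n c d) $$ (p div n, p mod n) * Y $$ (c, d)"])
  also have "\<dots> = T_map X Y $$ (p div n, p mod n)"
    by (rule T_map_matrix_unit_expansion[OF X Y ab, symmetric])
  finally show "(map_matrix n (T_map X) *\<^sub>v mat_coords n Y) $ p = mat_coords n (T_map X Y) $ p"
    using p by (simp add: mat_coords_def)
qed (simp add: map_matrix_def mat_coords_def)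

lemma size_eigenvalues_T_map: "size (proots (char_poly (map_matrix n (T_map X)))) = n * n"
  using degree_monic_char_poly[of "map_matrix n (T_map X)" "n * n"]
  by (simp add: size_proots_complex map_matrix_def)

lemma mat_trace_mult_adjoint:
  assumes A: "A \<in> carrier_mat n n" and B: "B \<in> carrier_mat n n"
  shows "mat_trace (A * mat_adjoint B) = (\<Sum>i<n. \<Sum>j<n. A $$ (i, j) * cnj (B $$ (i, j)))"
  using A mat_adjoint_carrier[OF B]
  by (auto simp: mat_trace_def scalar_prod_def atLeast0LessThan mat_adjoint_index[OF B]
      intro!: sum.cong)

lemma mat_trace_adjoint_square:
  assumes A: "A \<in> carrier_mat n n"
  shows "mat_trace (A * mat_adjoint A) = complex_of_real (\<Sum>i<n. \<Sum>j<n. (cmod (A $$ (i, j)))\<^sup>2)"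
  by (simp only: mat_trace_mult_adjoint[OF A A] of_real_sum complex_norm_square)

text \<open>\<open>\<langle>[X\<^sup>*, Z], Y\<rangle> = \<langle>Z, [X, Y]\<rangle>\<close>\<close>

lemma trace_commutator_adjoint:
  assumes X: "X \<in> carrier_mat n n" and Y: "Y \<in> carrier_mat n n" and Z: "Z \<in> carrier_mat n n"
  shows "mat_trace (commutator (mat_adjoint X) Z * mat_adjoint Y)
    = mat_trace (Z * mat_adjoint (commutator X Y))"
proof -
  have coef: "comm_coef (mat_adjoint X) a b c d = cnj (comm_coef X c d a b)"
    if "a < n" "b < n" "c < n" "d < n" for a b c d
    using that by (auto simp: comm_coef_def mat_adjoint_index[OF X])
  have "mat_trace (commutator (mat_adjoint X) Z * mat_adjoint Y)
    = (\<Sum>a<n. \<Sum>b<n. \<Sum>c<n. \<Sum>d<n. Z $$ (c, d) * cnj (comm_coef X c d a b * Y $$ (a, b)))"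
    unfolding mat_trace_mult_adjoint[OF commutator_carrier[OF mat_adjoint_carrier[OF X] Z] Y]
    by (intro sum.cong refl)
      (simp add: commutator_index[OF mat_adjoint_carrier[OF X] Z] coef sum_distrib_left mult_ac)
  also have "\<dots> = (\<Sum>c<n. \<Sum>d<n. \<Sum>a<n. \<Sum>b<n.
      Z $$ (c, d) * cnj (comm_coef X c d a b * Y $$ (a, b)))"
    by (rule sum_swap4)
  also have "\<dots> = mat_trace (Z * mat_adjoint (commutator X Y))"
    unfolding mat_trace_mult_adjoint[OF Z commutator_carrier[OF X Y]]
    by (intro sum.cong refl) (simp add: commutator_index[OF X Y] sum_distrib_left)
  finally show ?thesis .
qed

lemma eigenvalue_T_map_nonneg:
  assumes X: "X \<in> carrier_mat n n" and \<mu>: "\<mu> \<in># proots (char_poly (map_matrix n (T_map X)))"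
  shows "\<mu> \<in> \<real>" "Re \<mu> \<ge> 0"
proof -
  have c: "map_matrix n (T_map X) \<in> carrier_mat (n * n) (n * n)" by (simp add: map_matrix_def)
  then have "char_poly (map_matrix n (T_map X)) \<noteq> 0"
    using degree_monic_char_poly[OF c] by force
  then have "eigenvalue (map_matrix n (T_map X)) \<mu>"
    using \<mu> by (simp add: eigenvalue_root_char_poly[OF c])
  then obtain v where v: "v \<in> carrier_vec (n * n)" "v \<noteq> 0\<^sub>v (n * n)"
    and ev: "map_matrix n (T_map X) *\<^sub>v v = \<mu> \<cdot>\<^sub>v v"
    using c unfolding eigenvalue_def eigenvector_def by auto
  define Y where "Y = mat n n (\<lambda>(i, j). v $ (i * n + j))"
  have Y: "Y \<in> carrier_mat n n" by (simp add: Y_def)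
  have coords: "mat_coords n Y = v"
  proof (rule eq_vecI)
    fix p assume "p < dim_vec v"
    then have p: "p < n * n" using v by simp
    then have "n > 0" by (cases n) auto
    then show "mat_coords n Y $ p = v $ p"
      using p by (simp add: mat_coords_def Y_def less_mult_imp_div_less)
  qed (use v in \<open>simp add: mat_coords_def\<close>)
  have TY: "T_map X Y $$ (i, j) = \<mu> * Y $$ (i, j)" if "i < n" "j < n" for i j
  proof -
    have "mat_coords n (T_map X Y) = \<mu> \<cdot>\<^sub>v mat_coords n Y"
      using map_matrix_T_map[OF X Y] ev coords by simp
    then have "mat_coords n (T_map X Y) $ (i * n + j) = (\<mu> \<cdot>\<^sub>v mat_coords n Y) $ (i * n + j)"
      by simp
    then show ?thesis
      using that index_less[OF that] by (simp add: mat_coords_def)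
  qed
  define s where "s = (\<Sum>i<n. \<Sum>j<n. (cmod (Y $$ (i, j)))\<^sup>2)"
  define t where "t = (\<Sum>i<n. \<Sum>j<n. (cmod (commutator X Y $$ (i, j)))\<^sup>2)"
  have "\<mu> * of_real s = mat_trace (T_map X Y * mat_adjoint Y)"
    unfolding s_def mat_trace_mult_adjoint[OF T_map_carrier[OF X Y] Y]
    by (simp add: TY complex_norm_square sum_distrib_left mult.assoc del: of_real_power)
  also have "\<dots> = of_real t"
    unfolding T_map_def t_def trace_commutator_adjoint[OF X Y commutator_carrier[OF X Y]]
    by (rule mat_trace_adjoint_square[OF commutator_carrier[OF X Y]])
  finally have eq: "\<mu> * of_real s = of_real t" .
  obtain p where p: "p < n * n" "v $ p \<noteq> 0"
    using v by (metis carrier_vecD eq_vecI index_zero_vec)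
  then have "n > 0" by (cases n) auto
  then have ab: "p div n < n" "p mod n < n" using p by (auto simp: less_mult_imp_div_less)
  have "v $ p = Y $$ (p div n, p mod n)"
    using p by (simp add: coords[symmetric] mat_coords_def)
  then have "0 < (cmod (Y $$ (p div n, p mod n)))\<^sup>2" using p by simp
  also have "\<dots> \<le> (\<Sum>j<n. (cmod (Y $$ (p div n, j)))\<^sup>2)"
    by (rule member_le_sum) (use ab in auto)
  also have "\<dots> \<le> s" unfolding s_def
    by (rule member_le_sum[where f = "\<lambda>i. \<Sum>j<n. (cmod (Y $$ (i, j)))\<^sup>2"])
      (use ab in \<open>auto intro: sum_nonneg\<close>)
  finally have s: "s > 0" .
  have "t \<ge> 0" unfolding t_def by (intro sum_nonneg) simp
  have "\<mu> = of_real (t / s)" using eq s by (simp add: field_simps)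
  with s \<open>t \<ge> 0\<close> show "\<mu> \<in> \<real>" "Re \<mu> \<ge> 0" by simp_all
qed

end

theory Submission
  imports Defs "HOL-Analysis.Convex"
begin

text \<open>The bound holds for every number \<open>m\<close> of eigenvalues in the form
  \<open>\<lambda>\<^sub>1 + \<dots> + \<lambda>\<^sub>m \<le> m + 1 + \<surd>(2 m)\<close>; the case \<open>m = 2 k\<close> is the theorem.

  A unitary triangularization of \<open>T_map X\<close> with the eigenvalues in descending order on the diagonal
  turns the left-hand side into \<open>\<Sum>\<^sub>i \<langle>T_map X Y\<^sub>i, Y\<^sub>i\<rangle>\<close> for an orthonormal family
  \<open>Y\<^sub>1, \<dots>, Y\<^sub>m\<close> (lemma \<open>eig_desc_sum_attained\<close>), so it suffices to bound this sum for all
  orthonormal families (theorem \<open>orthonormal_commutator_sum_le\<close>). With \<open>X = A + \<i> B\<close> for Hermitian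
  \<open>A\<close> and \<open>B\<close>, expanding the commutators gives
  \<open>\<langle>T_map X Y, Y\<rangle> = Tr (X\<^sup>* X Y Y\<^sup>*) + Tr (Y X X\<^sup>* Y\<^sup>*) - 2 Tr (A Y A Y\<^sup>*) - 2 Tr (B Y B Y\<^sup>*)\<close>,
  and every term has the form \<open>Tr (P Y Q Y\<^sup>*)\<close> with Hermitian \<open>P\<close> and \<open>Q\<close>.

  Diagonalize \<open>P = U diag(p) U\<^sup>*\<close> and \<open>Q = V diag(q) V\<^sup>*\<close>. Then
  \<open>\<Sum>\<^sub>i Tr (P Y\<^sub>i Q Y\<^sub>i\<^sup>*) = \<Sum>\<^sub>j\<^sub>l p\<^sub>j q\<^sub>l w\<^sub>j\<^sub>l\<close> with \<open>w\<^sub>j\<^sub>l = \<Sum>\<^sub>i \<bar>(U\<^sup>* Y\<^sub>i V)\<^sub>j\<^sub>l\<bar>\<^sup>2\<close>.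
  These weights sum to \<open>m\<close> and, by Bessel's inequality, lie between 0 and 1. Two elementary
  estimates finish the proof:

  \<^item> The first two terms together are a weighted average of the row sums of \<open>w\<close> plus a weighted average
    of the column sums of \<open>w\<close>. A row and a column meet in one cell, of weight at most 1, so a row sum
    plus a column sum is at most \<open>m + 1\<close> (lemma \<open>row_column_average_le\<close>).

  \<^item> In \<open>- \<Sum>\<^sub>j\<^sub>l a\<^sub>j a\<^sub>l w\<^sub>j\<^sub>l\<close> only pairs of eigenvalues of opposite sign contribute positively, and the
    squares of their products sum to at most half of \<open>(\<Sum>\<^sub>j a\<^sub>j\<^sup>2)\<^sup>2\<close>. Cauchy-Schwarz bounds the sum by
    \<open>\<surd>(m / 2) \<parallel>A\<parallel>\<^sup>2\<close> (lemma \<open>opposite_sign_sum_le\<close>). As \<open>\<parallel>A\<parallel>\<^sup>2 + \<parallel>B\<parallel>\<^sup>2 = \<parallel>X\<parallel>\<^sup>2 = 1\<close>, the last two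
    terms contribute at most \<open>2 \<surd>(m / 2) = \<surd>(2 m)\<close>.\<close>

section \<open>Adjoint and trace\<close>

lemma mat_adjoint_mult:
  fixes A B :: "complex mat"
  assumes A: "A \<in> carrier_mat n m" and B: "B \<in> carrier_mat m p"
  shows "mat_adjoint (A * B) = mat_adjoint B * mat_adjoint A"
proof (rule eq_matI)
  note c = mat_adjoint_carrier[OF A] mat_adjoint_carrier[OF B]
    mat_adjoint_carrier[OF mult_carrier_mat[OF A B]]
  fix i j assume "i < dim_row (mat_adjoint B * mat_adjoint A)"
    "j < dim_col (mat_adjoint B * mat_adjoint A)"
  then have ij: "i < p" "j < n" using c by auto
  show "mat_adjoint (A * B) $$ (i, j) = (mat_adjoint B * mat_adjoint A) $$ (i, j)"
    using ij A B c
    by (auto simp: mat_adjoint_index[OF mult_carrier_mat[OF A B]] mat_adjoint_index[OF A]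
        mat_adjoint_index[OF B] scalar_prod_def mult.commute intro!: sum.cong)
qed (use mat_adjoint_carrier[OF A] mat_adjoint_carrier[OF B]
    mat_adjoint_carrier[OF mult_carrier_mat[OF A B]] in auto)

lemma mat_adjoint_adjoint:
  fixes A :: "complex mat"
  assumes A: "A \<in> carrier_mat n m"
  shows "mat_adjoint (mat_adjoint A) = A"
  using mat_adjoint_carrier[OF A] mat_adjoint_carrier[OF mat_adjoint_carrier[OF A]] A
  by (intro eq_matI) (auto simp: mat_adjoint_index[OF mat_adjoint_carrier[OF A]] mat_adjoint_index[OF A])

lemma mat_adjoint_one: "mat_adjoint (1\<^sub>m n) = (1\<^sub>m n :: complex mat)"
  by (rule eq_matI) (auto simp: mat_adjoint_def mat_of_rows_def)

lemma mat_trace_comm: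
  assumes A: "A \<in> carrier_mat n m" and B: "B \<in> carrier_mat m n"
  shows "mat_trace (A * B) = mat_trace (B * A)"
proof -
  have "mat_trace (A * B) = (\<Sum>i<n. \<Sum>j<m. A $$ (i, j) * B $$ (j, i))"
    using A B by (auto simp: mat_trace_def scalar_prod_def atLeast0LessThan intro!: sum.cong)
  also have "\<dots> = (\<Sum>j<m. \<Sum>i<n. B $$ (j, i) * A $$ (i, j))"
    by (subst sum.swap) (simp add: mult.commute)
  also have "\<dots> = mat_trace (B * A)"
    using A B by (auto simp: mat_trace_def scalar_prod_def atLeast0LessThan intro!: sum.cong)
  finally show ?thesis .
qed

lemma mat_trace_add:
  assumes "A \<in> carrier_mat n n" "B \<in> carrier_mat n n"
  shows "mat_trace (A + B) = mat_trace A + mat_trace B"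
  using assms by (simp add: mat_trace_def sum.distrib)

lemma mat_trace_minus:
  assumes "A \<in> carrier_mat n n" "B \<in> carrier_mat n n"
  shows "mat_trace (A - B) = mat_trace A - mat_trace B"
  using assms by (simp add: mat_trace_def sum_subtractf)

lemma mat_trace_smult:
  assumes "A \<in> carrier_mat n n"
  shows "mat_trace (c \<cdot>\<^sub>m A) = c * mat_trace A"
  using assms by (simp add: mat_trace_def sum_distrib_left)

section \<open>Unitary triangularization\<close>

definition unitary_mat :: "nat \<Rightarrow> complex mat \<Rightarrow> bool" where
  "unitary_mat n U \<longleftrightarrow> U \<in> carrier_mat n n \<and> mat_adjoint U * U = 1\<^sub>m n"

lemma unitary_matD:
  assumes "unitary_mat n U"
  shows "U \<in> carrier_mat n n" "mat_adjoint U \<in> carrier_mat n n"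
    "mat_adjoint U * U = 1\<^sub>m n" "U * mat_adjoint U = 1\<^sub>m n"
proof -
  show U: "U \<in> carrier_mat n n" and UU: "mat_adjoint U * U = 1\<^sub>m n"
    using assms by (auto simp: unitary_mat_def)
  show U': "mat_adjoint U \<in> carrier_mat n n" by (rule mat_adjoint_carrier[OF U])
  show "U * mat_adjoint U = 1\<^sub>m n"
    by (rule mat_mult_left_right_inverse[OF U' U UU])
qed

lemma unitary_mat_mult:
  assumes U: "unitary_mat n U" and V: "unitary_mat n V"
  shows "unitary_mat n (U * V)"
proof -
  note u = unitary_matD[OF U] and v = unitary_matD[OF V]
  have "mat_adjoint (U * V) * (U * V) = mat_adjoint V * mat_adjoint U * (U * V)"
    by (simp add: mat_adjoint_mult[OF u(1) v(1)])
  also have "\<dots> = mat_adjoint V * (mat_adjoint U * (U * V))"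
    by (rule assoc_mult_mat[OF v(2) u(2) mult_carrier_mat[OF u(1) v(1)]])
  also have "mat_adjoint U * (U * V) = mat_adjoint U * U * V"
    by (rule assoc_mult_mat[OF u(2) u(1) v(1), symmetric])
  also have "\<dots> = V" using v(1) by (simp add: u(3))
  finally show ?thesis using u(1) v(1,3) by (simp add: unitary_mat_def)
qed

text \<open>Gram-Schmidt applied to a basis that starts with \<open>v\<close> leaves \<open>v\<close> in first place; normalizing the
  resulting orthogonal vectors gives the columns of \<open>W\<close>.\<close>

lemma unitary_completion:
  fixes v :: "complex vec"
  assumes v: "v \<in> carrier_vec n" and v0: "v \<noteq> 0\<^sub>v n"
  obtains W c where "unitary_mat n W" "col W 0 = c \<cdot>\<^sub>v v"
proof -
  interpret cof_vec_space n "TYPE(complex)" .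
  define b where "b = basis_completion v"
  define ws where "ws = gram_schmidt n b"
  note bc = basis_completion[OF v v0, folded b_def]
  have n0: "0 < n"
  proof (rule ccontr)
    assume "\<not> 0 < n"
    then have "v = 0\<^sub>v n" using v by (intro eq_vecI) auto
    with v0 show False by simp
  qed
  with bc(6,7) obtain vs where bv: "b = v # vs" by (cases b) auto
  note gs = gram_schmidt_result[OF bc(2,4,5) ws_def]
  have len: "length ws = n" using gs(4) bc(6) by simp
  have "hd ws = v" unfolding ws_def bv using v by (rule gram_schmidt_hd)
  then have ws0: "ws ! 0 = v" using len n0 by (cases ws) auto
  have wsc: "ws ! i \<in> carrier_vec n" if "i < n" for i
    using gs(3) len that by (meson nth_mem subsetD)
  define s where "s i = (\<Sum>k<n. (cmod (ws ! i $ k))\<^sup>2)" for i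
  have ip: "ws ! i \<bullet>c ws ! j = (\<Sum>k<n. ws ! i $ k * cnj (ws ! j $ k))" if "i < n" "j < n" for i j
    using wsc[OF that(1)] wsc[OF that(2)] by (auto simp: scalar_prod_def atLeast0LessThan)
  have ips: "(\<Sum>k<n. ws ! i $ k * cnj (ws ! i $ k)) = complex_of_real (s i)" for i
    by (simp only: s_def of_real_sum complex_norm_square)
  have orth: "(\<Sum>k<n. ws ! i $ k * cnj (ws ! j $ k)) = 0" if "i < n" "j < n" "i \<noteq> j" for i j
    using corthogonalD[OF gs(2), of i j] that len by (simp add: ip)
  have "s i \<noteq> 0" if "i < n" for i
    using corthogonalD[OF gs(2), of i i] that len by (simp add: ip ips)
  moreover have "s i \<ge> 0" for i unfolding s_def by (intro sum_nonneg) simp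
  ultimately have spos: "s i > 0" if "i < n" for i using that by (metis less_eq_real_def)
  define W where "W = mat n n (\<lambda>(k, i). ws ! i $ k / complex_of_real (sqrt (s i)))"
  have W: "W \<in> carrier_mat n n" by (simp add: W_def)
  have "mat_adjoint W * W = 1\<^sub>m n"
  proof (rule eq_matI)
    fix i j assume "i < dim_row (1\<^sub>m n :: complex mat)" "j < dim_col (1\<^sub>m n :: complex mat)"
    then have ij: "i < n" "j < n" by auto
    have "(mat_adjoint W * W) $$ (i, j) = (\<Sum>k<n. cnj (W $$ (k, i)) * W $$ (k, j))"
      using ij W mat_adjoint_carrier[OF W]
      by (auto simp: scalar_prod_def atLeast0LessThan mat_adjoint_index[OF W] intro!: sum.cong)
    also have "\<dots> = (\<Sum>k<n. ws ! j $ k * cnj (ws ! i $ k)) /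
        (complex_of_real (sqrt (s i)) * complex_of_real (sqrt (s j)))"
      unfolding sum_divide_distrib using ij by (intro sum.cong) (auto simp: W_def)
    also have "\<dots> = (if i = j then 1 else 0)"
    proof (cases "i = j")
      case True
      have "complex_of_real (sqrt (s j)) * complex_of_real (sqrt (s j)) = complex_of_real (s j)"
        using spos[OF ij(2)] by (simp flip: of_real_mult)
      then show ?thesis using spos[OF ij(2)] True by (simp add: ips)
    qed (use ij orth in auto)
    finally show "(mat_adjoint W * W) $$ (i, j) = 1\<^sub>m n $$ (i, j)" using ij by simp
  qed (use W mat_adjoint_carrier[OF W] in auto)
  then have "unitary_mat n W" using W by (simp add: unitary_mat_def)
  moreover have "col W 0 = (1 / complex_of_real (sqrt (s 0))) \<cdot>\<^sub>v v"
    using n0 v by (intro eq_vecI) (auto simp: W_def ws0)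
  ultimately show ?thesis by (rule that)
qed

lemma mat_adjoint_four_block_diag:
  fixes A D :: "complex mat"
  assumes A: "A \<in> carrier_mat n n" and D: "D \<in> carrier_mat m m"
  shows "mat_adjoint (four_block_mat A (0\<^sub>m n m) (0\<^sub>m m n) D)
    = four_block_mat (mat_adjoint A) (0\<^sub>m n m) (0\<^sub>m m n) (mat_adjoint D)"
proof -
  have C: "four_block_mat A (0\<^sub>m n m) (0\<^sub>m m n) D \<in> carrier_mat (n + m) (n + m)"
    using A D by simp
  show ?thesis
    using A D mat_adjoint_carrier[OF A] mat_adjoint_carrier[OF D] mat_adjoint_carrier[OF C]
    by (intro eq_matI) (auto simp: mat_adjoint_index[OF C] mat_adjoint_index[OF A] mat_adjoint_index[OF D])
qed

text \<open>Schur's theorem, with the eigenvalues in any prescribed order on the diagonal: in an orthonormal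
  basis that starts with an eigenvector for the first of them, \<open>A\<close> is block triangular with a first
  block of size one, and the induction continues with the second block.\<close>

theorem unitary_schur:
  fixes A :: "complex mat"
  assumes A: "A \<in> carrier_mat n n" and c: "char_poly A = (\<Prod>e\<leftarrow>es. [:- e, 1:])"
  shows "\<exists>U. unitary_mat n U \<and> upper_triangular (mat_adjoint U * A * U)
    \<and> diag_mat (mat_adjoint U * A * U) = es"
  using A c
proof (induction es arbitrary: n A)
  case Nil
  with degree_monic_char_poly[of A n] have "n = 0" by simp
  with Nil show ?case
    by (intro exI[of _ "1\<^sub>m 0"]) (auto simp: unitary_mat_def diag_mat_def mat_adjoint_def)
next
  case (Cons e es)
  define k where "k = n - 1"
  note A = Cons.prems(1)
  have cp: "char_poly A = [:- e, 1:] * (\<Prod>e\<leftarrow>es. [:- e, 1:])" using Cons.prems by simp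
  have "monic (\<Prod>e\<leftarrow>es. [:- e, 1:])" by (rule monic_prod_list) auto
  then have "degree (char_poly A) = Suc (degree (\<Prod>e\<leftarrow>es. [:- e, 1:]))"
    unfolding cp by (subst degree_mult_eq) auto
  with degree_monic_char_poly[OF A] have n: "n = 1 + k" "0 < n" by (auto simp: k_def)
  have "eigenvalue A e" unfolding eigenvalue_root_char_poly[OF A] cp by simp
  then obtain v where v: "v \<in> carrier_vec n" "v \<noteq> 0\<^sub>v n" and Av: "A *\<^sub>v v = e \<cdot>\<^sub>v v"
    using A unfolding eigenvalue_def eigenvector_def by auto
  obtain W c where W: "unitary_mat n W" and W0: "col W 0 = c \<cdot>\<^sub>v v"
    by (rule unitary_completion[OF v])
  note w = unitary_matD[OF W]
  define A' where "A' = mat_adjoint W * A * W"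
  have A': "A' \<in> carrier_mat n n" unfolding A'_def using w A by simp
  have "col A' 0 = col (mat_adjoint W * (A * W)) 0"
    by (simp only: A'_def assoc_mult_mat[OF w(2) A w(1)])
  also have "\<dots> = mat_adjoint W *\<^sub>v (A *\<^sub>v col W 0)"
    by (simp only: col_mult2[OF w(2) mult_carrier_mat[OF A w(1)] n(2)] col_mult2[OF A w(1) n(2)])
  also have "A *\<^sub>v col W 0 = e \<cdot>\<^sub>v col W 0"
    unfolding W0 using A v by (simp add: mult_mat_vec[OF A v(1)] Av smult_smult_assoc mult.commute)
  also have "mat_adjoint W *\<^sub>v (e \<cdot>\<^sub>v col W 0) = e \<cdot>\<^sub>v (mat_adjoint W *\<^sub>v col W 0)"
    using w(1,2) by (intro mult_mat_vec[of _ n n]) (auto intro!: carrier_vecI)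
  also have "mat_adjoint W *\<^sub>v col W 0 = col (mat_adjoint W * W) 0"
    by (rule col_mult2[OF w(2) w(1) n(2), symmetric])
  also have "\<dots> = unit_vec n 0" unfolding w(3) using n by simp
  finally have col0: "col A' 0 = e \<cdot>\<^sub>v unit_vec n 0" .
  have A'0: "A' $$ (i, 0) = (if i = 0 then e else 0)" if "i < n" for i
  proof -
    have "A' $$ (i, 0) = col A' 0 $ i" using A' that n by simp
    then show ?thesis using col0 that n by simp
  qed
  obtain A1 A2 A0 A3 where split: "split_block A' 1 1 = (A1, A2, A0, A3)"
    by (cases "split_block A' 1 1")
  have "dim_row A' = 1 + k" "dim_col A' = 1 + k" using A' n by auto
  note sb = split_block[OF split this]
  have A1: "A1 = mat 1 1 (\<lambda>_. e)" and A0: "A0 = 0\<^sub>m k 1"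
    using split A' n A'0 by (auto simp: split_block_def Let_def)
  have block: "A' = four_block_mat A1 A2 (0\<^sub>m k 1) A3" using sb(5) A0 by simp
  have "similar_mat A' A"
    unfolding similar_mat_def similar_mat_wit_def
    by (rule exI[of _ "mat_adjoint W"], rule exI[of _ W])
      (use w A A' in \<open>auto simp: A'_def Let_def\<close>)
  then have "char_poly A1 * char_poly A3 = [:- e, 1:] * (\<Prod>e\<leftarrow>es. [:- e, 1:])"
    using char_poly_similar[of A' A] cp char_poly_four_block_zeros_col[OF sb(1,2,4)] block by simp
  moreover have "char_poly A1 = [:- e, 1:]"
    by (simp add: A1 char_poly_defs det_def sign_def)
  ultimately have "char_poly A3 = (\<Prod>e\<leftarrow>es. [:- e, 1:])"
    by (metis mult_cancel_left pCons_eq_0_iff zero_neq_one)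
  from Cons.IH[OF sb(4) this] obtain U where U: "unitary_mat k U"
    and tri: "upper_triangular (mat_adjoint U * A3 * U)"
    and dg: "diag_mat (mat_adjoint U * A3 * U) = es" by blast
  note u = unitary_matD[OF U]
  define V where "V = four_block_mat (1\<^sub>m 1) (0\<^sub>m 1 k) (0\<^sub>m k 1) U"
  have V: "V \<in> carrier_mat n n" unfolding V_def n(1) by (rule four_block_carrier_mat[OF one_carrier_mat u(1)])
  have adjV: "mat_adjoint V = four_block_mat (1\<^sub>m 1) (0\<^sub>m 1 k) (0\<^sub>m k 1) (mat_adjoint U)"
    unfolding V_def using mat_adjoint_four_block_diag[OF one_carrier_mat u(1)] by (simp add: mat_adjoint_one)
  have "mat_adjoint V * V = 1\<^sub>m n"
    unfolding adjV unfolding V_def using u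
    by (subst mult_four_block_mat[where ?nr1.0 = 1 and ?n1.0 = 1 and ?n2.0 = k and ?nr2.0 = k and ?nc1.0 = 1 and ?nc2.0 = k]) (auto simp: n)
  then have uV: "unitary_mat n V" using V by (simp add: unitary_mat_def)
  note sv = unitary_matD[OF uV]
  have "mat_adjoint V * A' = four_block_mat A1 A2 (0\<^sub>m k 1) (mat_adjoint U * A3)"
    unfolding adjV block using u sb
    by (subst mult_four_block_mat[where ?nr1.0 = 1 and ?n1.0 = 1 and ?n2.0 = k and ?nr2.0 = k and ?nc1.0 = 1 and ?nc2.0 = k]) auto
  then have VAV: "mat_adjoint V * A' * V =
      four_block_mat A1 (A2 * U) (0\<^sub>m k 1) (mat_adjoint U * A3 * U)"
    unfolding V_def using u sb
    by (simp, subst mult_four_block_mat[where ?nr1.0 = 1 and ?n1.0 = 1 and ?n2.0 = k and ?nr2.0 = k and ?nc1.0 = 1 and ?nc2.0 = k]) auto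
  have U3: "mat_adjoint U * A3 * U \<in> carrier_mat k k" using u sb by simp
  have "mat_adjoint (W * V) * A * (W * V) = mat_adjoint V * mat_adjoint W * A * (W * V)"
    by (simp add: mat_adjoint_mult[OF w(1) V])
  also have "\<dots> = mat_adjoint V * A' * V"
    unfolding A'_def using w A sv by (simp add: assoc_mult_mat[of _ n n _ n _ n])
  finally have eq: "mat_adjoint (W * V) * A * (W * V) =
      four_block_mat A1 (A2 * U) (0\<^sub>m k 1) (mat_adjoint U * A3 * U)"
    using VAV by simp
  have "upper_triangular A1" by (simp add: A1 upper_triangular_def)
  then have "upper_triangular (mat_adjoint (W * V) * A * (W * V))"
    unfolding eq by (rule upper_triangular_four_block[OF sb(1) U3 _ tri])
  moreover have "diag_mat (mat_adjoint (W * V) * A * (W * V)) = e # es"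
    unfolding eq diag_four_block_mat[OF sb(1) U3] dg by (simp add: A1 diag_mat_def)
  ultimately show ?case using unitary_mat_mult[OF W uV] by blast
qed

section \<open>Diagonalization of Hermitian matrices\<close>

lemma char_poly_eq_prod_list:
  fixes A :: "complex mat"
  assumes A: "A \<in> carrier_mat n n" and es: "mset es = proots (char_poly A)"
  shows "char_poly A = (\<Prod>e\<leftarrow>es. [:- e, 1:])"
proof -
  have "char_poly A = smult (lead_coeff (char_poly A)) (\<Prod>e\<in>#proots (char_poly A). [:- e, 1:])"
    by (rule complex_poly_decompose_multiset[symmetric])
  also have "\<dots> = (\<Prod>e\<in>#mset es. [:- e, 1:])"
    using degree_monic_char_poly[OF A] by (simp add: es)
  also have "\<dots> = (\<Prod>e\<leftarrow>es. [:- e, 1:])" by (simp flip: prod_mset_prod_list)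
  finally show ?thesis .
qed

lemma unitary_conjugate_cancel:
  assumes U: "unitary_mat n U" and A: "A \<in> carrier_mat n n"
  shows "U * (mat_adjoint U * A * U) * mat_adjoint U = A"
proof -
  note u = unitary_matD[OF U]
  have "U * (mat_adjoint U * A * U) * mat_adjoint U = (U * mat_adjoint U) * A * (U * mat_adjoint U)"
    using u(1,2) A by (simp add: assoc_mult_mat[of _ n n _ n _ n])
  then show ?thesis unfolding u(4) using A by simp
qed

definition rdiag :: "nat \<Rightarrow> (nat \<Rightarrow> real) \<Rightarrow> complex mat" where
  "rdiag n d = mat n n (\<lambda>(i, j). if i = j then complex_of_real (d i) else 0)"

lemma rdiag_carrier [simp]: "rdiag n d \<in> carrier_mat n n"
  by (simp add: rdiag_def)

lemma rdiag_mult_index: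
  assumes "Z \<in> carrier_mat n n" "j < n" "l < n"
  shows "(rdiag n d * Z) $$ (j, l) = complex_of_real (d j) * Z $$ (j, l)"
  using assms by (simp add: rdiag_def scalar_prod_def if_distrib[where f = "\<lambda>x. x * _"] cong: if_cong)

lemma mult_rdiag_index:
  assumes "Z \<in> carrier_mat n n" "j < n" "l < n"
  shows "(Z * rdiag n d) $$ (j, l) = Z $$ (j, l) * complex_of_real (d l)"
  using assms by (simp add: rdiag_def scalar_prod_def if_distrib[where f = "\<lambda>x. _ * x"] cong: if_cong)

text \<open>A triangular matrix that equals its adjoint is a real diagonal matrix.\<close>

theorem hermitian_spectral:
  fixes A :: "complex mat"
  assumes A: "A \<in> carrier_mat n n" and herm: "mat_adjoint A = A"
  obtains U d where "unitary_mat n U" "A = U * rdiag n d * mat_adjoint U"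
proof -
  obtain es where "mset es = proots (char_poly A)" using ex_mset by blast
  from unitary_schur[OF A char_poly_eq_prod_list[OF A this]]
  obtain U where U: "unitary_mat n U" and tri: "upper_triangular (mat_adjoint U * A * U)" by blast
  note u = unitary_matD[OF U]
  define B where "B = mat_adjoint U * A * U"
  have B: "B \<in> carrier_mat n n" using u A by (simp add: B_def)
  have "mat_adjoint B = mat_adjoint U * (mat_adjoint A * mat_adjoint (mat_adjoint U))"
    unfolding B_def
    by (simp add: mat_adjoint_mult[OF mult_carrier_mat[OF u(2) A] u(1)] mat_adjoint_mult[OF u(2) A])
  also have "\<dots> = B"
    unfolding B_def herm mat_adjoint_adjoint[OF u(1)] using u(1,2) A
    by (simp add: assoc_mult_mat[of _ n n _ n _ n])
  finally have BB: "mat_adjoint B = B" .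
  have cnjB: "B $$ (i, j) = cnj (B $$ (j, i))" if "i < n" "j < n" for i j
    using mat_adjoint_index[OF B that] BB by simp
  have low: "B $$ (i, j) = 0" if "j < i" "i < n" for i j
    using tri that B unfolding B_def[symmetric] by (auto simp: upper_triangular_def)
  have "B = rdiag n (\<lambda>i. Re (B $$ (i, i)))"
  proof (rule eq_matI)
    fix i j
    assume "i < dim_row (rdiag n (\<lambda>i. Re (B $$ (i, i))))" "j < dim_col (rdiag n (\<lambda>i. Re (B $$ (i, i))))"
    then have ij: "i < n" "j < n" by (auto simp: rdiag_def)
    have "B $$ (i, i) = complex_of_real (Re (B $$ (i, i)))"
      using cnjB[OF ij(1) ij(1)] by (simp add: complex_eq_iff)
    moreover have "B $$ (i, j) = 0" if "i \<noteq> j"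
      using low[of j i] low[of i j] cnjB[OF ij] ij that by (cases "i < j") auto
    ultimately show "B $$ (i, j) = rdiag n (\<lambda>i. Re (B $$ (i, i))) $$ (i, j)"
      using ij by (auto simp: rdiag_def)
  qed (use B in \<open>auto simp: rdiag_def\<close>)
  then have "A = U * rdiag n (\<lambda>i. Re (B $$ (i, i))) * mat_adjoint U"
    using unitary_conjugate_cancel[OF U A] by (simp add: B_def[symmetric])
  with U show ?thesis by (rule that)
qed

section \<open>Sums of largest eigenvalues and orthonormal families\<close>

definition orthonormal_mats :: "nat \<Rightarrow> nat \<Rightarrow> (nat \<Rightarrow> complex mat) \<Rightarrow> bool" where
  "orthonormal_mats n m Y \<longleftrightarrow> (\<forall>i<m. Y i \<in> carrier_mat n n) \<and>
     (\<forall>i<m. \<forall>j<m. mat_trace (Y i * mat_adjoint (Y j)) = (if i = j then 1 else 0))"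

text \<open>The matrices \<open>Y i\<close> have the columns of a triangularizing unitary matrix \<open>U\<close> as coordinates. If \<open>M\<close>
  is the matrix of \<open>T_map X\<close>, then \<open>\<langle>T_map X (Y i), Y i\<rangle>\<close> is the \<open>i\<close>-th diagonal entry of \<open>U\<^sup>* M U\<close>.\<close>

lemma orthonormal_mats_attaining_eigenvalues:
  assumes X: "X \<in> carrier_mat n n"
    and es: "mset es = proots (char_poly (map_matrix n (T_map X)))"
  obtains Y where "orthonormal_mats n (n * n) Y"
    "\<And>i. i < n * n \<Longrightarrow> mat_trace (T_map X (Y i) * mat_adjoint (Y i)) = es ! i"
proof -
  define M where "M = map_matrix n (T_map X)"
  have M: "M \<in> carrier_mat (n * n) (n * n)" by (simp add: M_def map_matrix_def)
  obtain U where U: "unitary_mat (n * n) U" and dg: "diag_mat (mat_adjoint U * M * U) = es"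
    using unitary_schur[OF M char_poly_eq_prod_list[OF M es[folded M_def]]] by blast
  note u = unitary_matD[OF U]
  define Y where "Y i = mat n n (\<lambda>(a, b). U $$ (a * n + b, i))" for i
  have Y: "Y i \<in> carrier_mat n n" for i by (simp add: Y_def)
  have coords: "mat_coords n (Y i) = col U i" if "i < n * n" for i
  proof (rule eq_vecI)
    fix p assume "p < dim_vec (col U i)"
    then have p: "p < n * n" using u by simp
    then have "n > 0" by (cases n) auto
    then show "mat_coords n (Y i) $ p = col U i $ p"
      using p that u(1) by (simp add: mat_coords_def Y_def less_mult_imp_div_less)
  qed (use u in \<open>simp add: mat_coords_def\<close>)
  have trace_coords: "mat_trace (A * mat_adjoint B)
      = (\<Sum>p<n*n. mat_coords n A $ p * cnj (mat_coords n B $ p))"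
    if "A \<in> carrier_mat n n" "B \<in> carrier_mat n n" for A B
    unfolding mat_trace_mult_adjoint[OF that]
    using sum_div_mod[of "\<lambda>i j. A $$ (i, j) * cnj (B $$ (i, j))" n]
    by (simp add: mat_coords_def)
  have "mat_trace (Y i * mat_adjoint (Y j)) = (if i = j then 1 else 0)"
    if ij: "i < n * n" "j < n * n" for i j
  proof -
    have "mat_trace (Y i * mat_adjoint (Y j)) = (mat_adjoint U * U) $$ (j, i)"
      using ij u(1,2) by (auto simp: trace_coords[OF Y Y] coords scalar_prod_def atLeast0LessThan
        mat_adjoint_index[OF u(1)] mult.commute intro!: sum.cong)
    then show ?thesis using ij by (simp add: u(3))
  qed
  then have "orthonormal_mats n (n * n) Y" by (simp add: orthonormal_mats_def Y)
  moreover have "mat_trace (T_map X (Y i) * mat_adjoint (Y i)) = es ! i" if i: "i < n * n" for i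
  proof -
    have "mat_trace (T_map X (Y i) * mat_adjoint (Y i))
        = (\<Sum>p<n*n. (M *\<^sub>v col U i) $ p * cnj (U $$ (p, i)))"
      using i u(1) by (simp add: trace_coords[OF T_map_carrier[OF X Y] Y]
        map_matrix_T_map[OF X Y, symmetric] coords M_def)
    also have "\<dots> = row (mat_adjoint U) i \<bullet> (M *\<^sub>v col U i)"
      using i u(1,2) M by (simp add: scalar_prod_def[of "row _ _" "_ *\<^sub>v _"] atLeast0LessThan
        mat_adjoint_index[OF u(1)] mult.commute del: index_mult_mat_vec)
    also have "\<dots> = row (mat_adjoint U) i \<bullet> col (M * U) i"
      by (simp only: col_mult2[OF M u(1) i])
    also have "\<dots> = (mat_adjoint U * (M * U)) $$ (i, i)"
      by (rule index_mult_mat(1)[symmetric]) (use i u(1,2) in auto)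
    also have "\<dots> = diag_mat (mat_adjoint U * M * U) ! i"
      using i u(1,2) M by (simp add: diag_mat_def assoc_mult_mat[OF u(2) M u(1)])
    finally show ?thesis by (simp add: dg)
  qed
  ultimately show ?thesis by (rule that)
qed

text \<open>The maximum in Ky Fan's variational principle is attained: triangularize with the eigenvalues in
  descending order and take the first \<open>m\<close> basis vectors.\<close>

lemma eig_desc_sum_attained:
  assumes X: "X \<in> carrier_mat n n" and m: "m \<le> n * n"
  obtains Y where "orthonormal_mats n m Y"
    "(\<Sum>i = 1..m. eig_desc n (T_map X) i)
      = (\<Sum>i<m. Re (mat_trace (T_map X (Y i) * mat_adjoint (Y i))))"
proof -
  obtain xs where xs: "mset xs = proots (char_poly (map_matrix n (T_map X)))" using ex_mset by blast
  define es where "es = rev (sort_key Re xs)"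
  have es: "mset es = proots (char_poly (map_matrix n (T_map X)))" by (simp add: es_def xs)
  have len: "length es = n * n"
    using size_eigenvalues_T_map[of n X] by (simp flip: es)
  have "sort (map Re xs) = map Re (sort_key Re xs)"
    by (rule properties_for_sort) (auto simp: sorted_sort_key)
  then have "rev (sorted_list_of_multiset (image_mset Re (mset xs))) = map Re es"
    by (simp add: es_def rev_map flip: mset_map)
  then have eig: "eig_desc n (T_map X) i = map Re es ! (i - 1)" for i
    by (simp add: eig_desc_def xs)
  obtain Y where Y: "orthonormal_mats n (n * n) Y"
    and YT: "\<And>i. i < n * n \<Longrightarrow> mat_trace (T_map X (Y i) * mat_adjoint (Y i)) = es ! i"
    using orthonormal_mats_attaining_eigenvalues[OF X es] by blast
  have "(\<Sum>i = 1..m. eig_desc n (T_map X) i) = (\<Sum>i<m. map Re es ! i)"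
    by (rule sum.reindex_bij_witness[of _ Suc "\<lambda>i. i - 1"]) (auto simp: eig)
  also have "\<dots> = (\<Sum>i<m. Re (mat_trace (T_map X (Y i) * mat_adjoint (Y i))))"
    using m len by (intro sum.cong) (auto simp: YT)
  finally show ?thesis using Y m by (intro that[of Y]) (auto simp: orthonormal_mats_def)
qed

section \<open>Weights of an orthonormal family in a pair of bases\<close>

lemma orthonormal_mats_unitary:
  assumes Y: "orthonormal_mats n m Y" and U: "unitary_mat n U" and V: "unitary_mat n V"
  shows "orthonormal_mats n m (\<lambda>i. mat_adjoint U * Y i * V)"
proof -
  note u = unitary_matD[OF U] and v = unitary_matD[OF V]
  have c: "Y i \<in> carrier_mat n n" if "i < m" for i using Y that by (simp add: orthonormal_mats_def)
  have "mat_trace (mat_adjoint U * Y i * V * mat_adjoint (mat_adjoint U * Y j * V))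
      = mat_trace (Y i * mat_adjoint (Y j))" if ij: "i < m" "j < m" for i j
  proof -
    note ci = c[OF ij(1)] and cj = c[OF ij(2)]
    have cj': "mat_adjoint (Y j) \<in> carrier_mat n n" by (rule mat_adjoint_carrier[OF cj])
    have "mat_adjoint U * Y i * V * mat_adjoint (mat_adjoint U * Y j * V)
        = mat_adjoint U * Y i * V * (mat_adjoint V * (mat_adjoint (Y j) * U))"
      by (simp add: mat_adjoint_mult[OF mult_carrier_mat[OF u(2) cj] v(1)]
        mat_adjoint_mult[OF u(2) cj] mat_adjoint_adjoint[OF u(1)])
    also have "\<dots> = mat_adjoint U * (Y i * (V * mat_adjoint V) * mat_adjoint (Y j) * U)"
      using u(1,2) v(1,2) ci cj' by (simp add: assoc_mult_mat[of _ n n _ n _ n])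
    also have "\<dots> = mat_adjoint U * (Y i * mat_adjoint (Y j) * U)"
      unfolding v(4) using ci by simp
    also have "mat_trace \<dots> = mat_trace (Y i * mat_adjoint (Y j) * U * mat_adjoint U)"
      by (rule mat_trace_comm) (use u(1,2) ci cj' in auto)
    also have "Y i * mat_adjoint (Y j) * U * mat_adjoint U
        = Y i * mat_adjoint (Y j) * (U * mat_adjoint U)"
      by (rule assoc_mult_mat) (use u(1,2) ci cj' in auto)
    also have "\<dots> = Y i * mat_adjoint (Y j)" unfolding u(4) using ci cj' by simp
    finally show ?thesis .
  qed
  moreover have "mat_adjoint U * Y i * V \<in> carrier_mat n n" if "i < m" for i
    using u(2) v(1) c[OF that] by simp
  ultimately show ?thesis using Y by (simp add: orthonormal_mats_def)
qed

text \<open>Bessel's inequality for a matrix unit \<open>E\<close>. Let \<open>H\<close> be the orthogonal projection of \<open>E\<close> to the span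
  of the family and \<open>s\<close> the sum in question. Then \<open>s\<close> is both the entry of \<open>H\<close> at \<open>(a, b)\<close> and the
  squared norm of \<open>H\<close>, whence \<open>s\<^sup>2 \<le> s\<close>.\<close>

lemma orthonormal_mats_entry_le_1:
  assumes Y: "orthonormal_mats n m Y" and ab: "a < n" "b < n"
  shows "(\<Sum>i<m. (cmod (Y i $$ (a, b)))\<^sup>2) \<le> 1"
proof -
  define s where "s = (\<Sum>i<m. (cmod (Y i $$ (a, b)))\<^sup>2)"
  define H where "H c d = (\<Sum>i<m. cnj (Y i $$ (a, b)) * Y i $$ (c, d))" for c d
  have c: "Y i \<in> carrier_mat n n" if "i < m" for i using Y that by (simp add: orthonormal_mats_def)
  have on: "(\<Sum>c<n. \<Sum>d<n. Y i $$ (c, d) * cnj (Y j $$ (c, d))) = (if i = j then 1 else 0)"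
    if "i < m" "j < m" for i j
    using Y that by (simp add: orthonormal_mats_def mat_trace_mult_adjoint[OF c c, symmetric])
  have Hab: "H a b = complex_of_real s"
    unfolding H_def s_def of_real_sum complex_norm_square by (simp add: mult.commute)
  have "complex_of_real (\<Sum>c<n. \<Sum>d<n. (cmod (H c d))\<^sup>2)
      = (\<Sum>c<n. \<Sum>d<n. H c d * cnj (H c d))"
    by (simp only: of_real_sum complex_norm_square)
  also have "\<dots> = (\<Sum>c<n. \<Sum>d<n. \<Sum>i<m. \<Sum>j<m.
      cnj (Y i $$ (a, b)) * Y j $$ (a, b) * (Y i $$ (c, d) * cnj (Y j $$ (c, d))))"
    by (simp add: H_def sum_product mult_ac)
  also have "\<dots> = (\<Sum>i<m. \<Sum>j<m. \<Sum>c<n. \<Sum>d<n.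
      cnj (Y i $$ (a, b)) * Y j $$ (a, b) * (Y i $$ (c, d) * cnj (Y j $$ (c, d))))"
    by (rule sum_swap4)
  also have "\<dots> = (\<Sum>i<m. \<Sum>j<m. cnj (Y i $$ (a, b)) * Y j $$ (a, b) * (if i = j then 1 else 0))"
    by (intro sum.cong refl) (simp add: sum_distrib_left[symmetric] on)
  also have "\<dots> = H a b" by (simp add: H_def if_distrib[where f = "\<lambda>x. _ * x"] cong: if_cong)
  finally have norm: "(\<Sum>c<n. \<Sum>d<n. (cmod (H c d))\<^sup>2) = s"
    unfolding Hab of_real_eq_iff .
  have s0: "s \<ge> 0" unfolding s_def by (intro sum_nonneg) simp
  have "s\<^sup>2 = (cmod (H a b))\<^sup>2" by (simp add: Hab)
  also have "\<dots> \<le> (\<Sum>d<n. (cmod (H a d))\<^sup>2)"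
    by (rule member_le_sum) (use ab in auto)
  also have "\<dots> \<le> (\<Sum>c<n. \<Sum>d<n. (cmod (H c d))\<^sup>2)"
    by (rule member_le_sum[where f = "\<lambda>c. \<Sum>d<n. (cmod (H c d))\<^sup>2"])
      (use ab in \<open>auto intro: sum_nonneg\<close>)
  finally have "s * s \<le> s * 1" unfolding norm by (simp add: power2_eq_square)
  then have "s \<le> 1" using s0 by (cases "s = 0") (auto simp: mult_le_cancel_left)
  then show ?thesis by (simp add: s_def)
qed

text \<open>If \<open>\<Pi>\<close> is the orthogonal projection to the span of the family, and \<open>u\<^sub>j\<close>, \<open>v\<^sub>l\<close> are the columns of
  \<open>U\<close> and \<open>V\<close>, then the weight at \<open>(j, l)\<close> is \<open>\<langle>\<Pi> E, E\<rangle>\<close> for the unit vector \<open>E = u\<^sub>j v\<^sub>l\<^sup>*\<close>.\<close>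

definition weight :: "nat \<Rightarrow> (nat \<Rightarrow> complex mat) \<Rightarrow> complex mat \<Rightarrow> complex mat \<Rightarrow> nat \<Rightarrow> nat \<Rightarrow> real" where
  "weight m Y U V j l = (\<Sum>i<m. (cmod ((mat_adjoint U * Y i * V) $$ (j, l)))\<^sup>2)"

lemma weight_nonneg: "weight m Y U V j l \<ge> 0"
  unfolding weight_def by (intro sum_nonneg) simp

lemma weight_le_1:
  assumes "orthonormal_mats n m Y" "unitary_mat n U" "unitary_mat n V" "j < n" "l < n"
  shows "weight m Y U V j l \<le> 1"
  unfolding weight_def
  using orthonormal_mats_entry_le_1[OF orthonormal_mats_unitary[OF assms(1-3)] assms(4,5)] .

lemma sum_weight:
  assumes Y: "orthonormal_mats n m Y" and U: "unitary_mat n U" and V: "unitary_mat n V"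
  shows "(\<Sum>j<n. \<Sum>l<n. weight m Y U V j l) = m"
proof -
  define Z where "Z i = mat_adjoint U * Y i * V" for i
  have Z: "orthonormal_mats n m Z"
    unfolding Z_def by (rule orthonormal_mats_unitary[OF Y U V])
  have one: "(\<Sum>j<n. \<Sum>l<n. (cmod (Z i $$ (j, l)))\<^sup>2) = 1" if "i < m" for i
  proof -
    have "Z i \<in> carrier_mat n n" "mat_trace (Z i * mat_adjoint (Z i)) = 1"
      using Z that by (auto simp: orthonormal_mats_def)
    then show ?thesis by (simp add: mat_trace_adjoint_square del: of_real_sum)
  qed
  have "(\<Sum>j<n. \<Sum>l<n. weight m Y U V j l) = (\<Sum>j<n. \<Sum>l<n. \<Sum>i<m. (cmod (Z i $$ (j, l)))\<^sup>2)"
    by (simp add: weight_def Z_def)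
  also have "\<dots> = (\<Sum>j<n. \<Sum>i<m. \<Sum>l<n. (cmod (Z i $$ (j, l)))\<^sup>2)"
    by (rule sum.cong[OF refl], rule sum.swap)
  also have "\<dots> = (\<Sum>i<m. \<Sum>j<n. \<Sum>l<n. (cmod (Z i $$ (j, l)))\<^sup>2)" by (rule sum.swap)
  finally show ?thesis by (simp add: one)
qed

section \<open>Traces in terms of weights\<close>

definition sandwich :: "complex mat \<Rightarrow> complex mat \<Rightarrow> complex mat \<Rightarrow> complex" where
  "sandwich Y P Q = mat_trace (P * Y * Q * mat_adjoint Y)"

text \<open>With \<open>Z = U\<^sup>* Y V\<close>, cyclicity of the trace turns \<open>Tr (A Y B Y\<^sup>*)\<close> into
  \<open>Tr (diag(a) Z diag(b) Z\<^sup>*)\<close>.\<close>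

lemma sandwich_spectral:
  assumes Y: "Y \<in> carrier_mat n n" and U: "unitary_mat n U" and V: "unitary_mat n V"
    and A: "A = U * rdiag n a * mat_adjoint U" and B: "B = V * rdiag n b * mat_adjoint V"
  shows "sandwich Y A B = complex_of_real
    (\<Sum>j<n. \<Sum>l<n. a j * b l * (cmod ((mat_adjoint U * Y * V) $$ (j, l)))\<^sup>2)"
proof -
  note u = unitary_matD[OF U] and v = unitary_matD[OF V] and Y' = mat_adjoint_carrier[OF Y]
  define Z where "Z = mat_adjoint U * Y * V"
  define D where "D = rdiag n a"
  define E where "E = rdiag n b"
  have Z: "Z \<in> carrier_mat n n" and D: "D \<in> carrier_mat n n" and E: "E \<in> carrier_mat n n"
    using u(2) Y v(1) by (auto simp: Z_def D_def E_def)
  have Z': "mat_adjoint Z = mat_adjoint V * (mat_adjoint Y * U)"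
    unfolding Z_def by (simp add: mat_adjoint_mult[OF mult_carrier_mat[OF u(2) Y] v(1)]
        mat_adjoint_mult[OF u(2) Y] mat_adjoint_adjoint[OF u(1)])
  have "A * Y * B * mat_adjoint Y = U * (D * Z * E * (mat_adjoint V * mat_adjoint Y))"
    unfolding A B Z_def D_def[symmetric] E_def[symmetric] using u(1,2) v(1,2) Y Y' D E
    by (simp add: assoc_mult_mat[of _ n n _ n _ n])
  also have "mat_trace \<dots> = mat_trace (D * Z * E * (mat_adjoint V * mat_adjoint Y) * U)"
    by (rule mat_trace_comm) (use u(1,2) v(1,2) Y Y' D E Z in auto)
  also have "D * Z * E * (mat_adjoint V * mat_adjoint Y) * U = D * Z * E * mat_adjoint Z"
    unfolding Z' using u(1,2) v(1,2) Y Y' D E Z by (simp add: assoc_mult_mat[of _ n n _ n _ n])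
  also have "mat_trace \<dots> = (\<Sum>j<n. \<Sum>l<n. (D * Z * E) $$ (j, l) * cnj (Z $$ (j, l)))"
    by (rule mat_trace_mult_adjoint) (use D Z E in auto)
  also have "\<dots> = (\<Sum>j<n. \<Sum>l<n. complex_of_real (a j * b l * (cmod (Z $$ (j, l)))\<^sup>2))"
    by (intro sum.cong refl)
      (simp add: D_def E_def mult_rdiag_index[OF mult_carrier_mat[OF rdiag_carrier Z]]
        rdiag_mult_index[OF Z] complex_norm_square del: of_real_power)
  finally show ?thesis by (simp add: sandwich_def Z_def)
qed

lemma sum_sandwich_spectral:
  assumes Y: "orthonormal_mats n m Y" and U: "unitary_mat n U" and V: "unitary_mat n V"
    and A: "A = U * rdiag n a * mat_adjoint U" and B: "B = V * rdiag n b * mat_adjoint V"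
  shows "(\<Sum>i<m. sandwich (Y i) A B)
    = complex_of_real (\<Sum>j<n. \<Sum>l<n. a j * b l * weight m Y U V j l)"
proof -
  define z where "z i j l = (cmod ((mat_adjoint U * Y i * V) $$ (j, l)))\<^sup>2" for i j l
  have "(\<Sum>i<m. sandwich (Y i) A B)
      = (\<Sum>i<m. complex_of_real (\<Sum>j<n. \<Sum>l<n. a j * b l * z i j l))"
    using Y by (intro sum.cong refl)
      (simp add: sandwich_spectral[OF _ U V A B] orthonormal_mats_def z_def del: of_real_sum)
  also have "\<dots> = complex_of_real (\<Sum>i<m. \<Sum>j<n. \<Sum>l<n. a j * b l * z i j l)" by simp
  also have "(\<Sum>i<m. \<Sum>j<n. \<Sum>l<n. a j * b l * z i j l) = (\<Sum>j<n. \<Sum>i<m. \<Sum>l<n. a j * b l * z i j l)"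
    by (rule sum.swap)
  also have "\<dots> = (\<Sum>j<n. \<Sum>l<n. \<Sum>i<m. a j * b l * z i j l)"
    by (rule sum.cong[OF refl], rule sum.swap)
  also have "\<dots> = (\<Sum>j<n. \<Sum>l<n. a j * b l * weight m Y U V j l)"
    by (simp add: weight_def z_def sum_distrib_left)
  finally show ?thesis .
qed

text \<open>The case \<open>Y = 1\<close>, \<open>U = V\<close> of the trace formula above: there \<open>Z\<close> is the identity matrix.\<close>

lemma mat_trace_mult_common_eigenbasis:
  assumes U: "unitary_mat n U"
    and A: "A = U * rdiag n a * mat_adjoint U" and B: "B = U * rdiag n b * mat_adjoint U"
  shows "mat_trace (A * B) = complex_of_real (\<Sum>j<n. a j * b j)"
proof -
  note u = unitary_matD[OF U]
  have c: "A \<in> carrier_mat n n" "B \<in> carrier_mat n n" unfolding A B using u by auto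
  have "mat_trace (A * B) = sandwich (1\<^sub>m n) A B"
    using c by (simp add: sandwich_def mat_adjoint_one)
  also have "\<dots> = complex_of_real
      (\<Sum>j<n. \<Sum>l<n. a j * b l * (cmod ((mat_adjoint U * 1\<^sub>m n * U) $$ (j, l)))\<^sup>2)"
    by (rule sandwich_spectral[OF _ U U A B]) simp
  also have "(\<Sum>j<n. \<Sum>l<n. a j * b l * (cmod ((mat_adjoint U * 1\<^sub>m n * U) $$ (j, l)))\<^sup>2)
      = (\<Sum>j<n. \<Sum>l<n. if j = l then a j * b l else 0)"
    using u by (intro sum.cong refl) auto
  also have "\<dots> = (\<Sum>j<n. a j * b j)" by simp
  finally show ?thesis .
qed

lemma one_spectral:
  assumes "unitary_mat n U"
  shows "1\<^sub>m n = U * rdiag n (\<lambda>_. 1) * mat_adjoint U"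
proof -
  have "rdiag n (\<lambda>_. 1) = 1\<^sub>m n" by (rule eq_matI) (auto simp: rdiag_def)
  then show ?thesis using unitary_matD[OF assms] by simp
qed

text \<open>The numbers \<open>d j\<close> are the squared norms of the columns of \<open>X U\<close>, i.e. the squared singular values
  of \<open>X\<close>.\<close>

lemma gram_spectral:
  assumes X: "X \<in> carrier_mat n n"
  obtains U d where "unitary_mat n U" "mat_adjoint X * X = U * rdiag n d * mat_adjoint U"
    "\<And>j. j < n \<Longrightarrow> d j \<ge> 0" "mat_trace (mat_adjoint X * X) = complex_of_real (\<Sum>j<n. d j)"
proof -
  note X' = mat_adjoint_carrier[OF X]
  define G where "G = mat_adjoint X * X"
  have G: "G \<in> carrier_mat n n" using X X' by (simp add: G_def)
  have "mat_adjoint G = G"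
    unfolding G_def by (simp add: mat_adjoint_mult[OF X' X] mat_adjoint_adjoint[OF X])
  then obtain U d where U: "unitary_mat n U" and GU: "G = U * rdiag n d * mat_adjoint U"
    by (rule hermitian_spectral[OF G])
  note u = unitary_matD[OF U]
  define E where "E = rdiag n d"
  have E: "E \<in> carrier_mat n n" by (simp add: E_def)
  have "mat_adjoint U * G * U = (mat_adjoint U * U) * E * (mat_adjoint U * U)"
    unfolding GU E_def[symmetric] using u(1,2) E by (simp add: assoc_mult_mat[of _ n n _ n _ n])
  then have "rdiag n d = mat_adjoint U * G * U"
    unfolding u(3) E_def[symmetric] using E by simp
  also have "\<dots> = mat_adjoint (X * U) * (X * U)"
    unfolding G_def mat_adjoint_mult[OF X u(1)] using u(1,2) X X'
    by (simp add: assoc_mult_mat[of _ n n _ n _ n])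
  finally have D: "rdiag n d = mat_adjoint (X * U) * (X * U)" .
  have "d j \<ge> 0" if j: "j < n" for j
  proof -
    note XU = mult_carrier_mat[OF X u(1)]
    have "complex_of_real (d j) = (mat_adjoint (X * U) * (X * U)) $$ (j, j)"
      using j by (simp flip: D) (simp add: rdiag_def)
    also have "\<dots> = (\<Sum>k<n. (X * U) $$ (k, j) * cnj ((X * U) $$ (k, j)))"
    proof -
      define P where "P = X * U"
      have P: "P \<in> carrier_mat n n" using XU by (simp add: P_def)
      show ?thesis unfolding P_def[symmetric]
        using j P mat_adjoint_carrier[OF P]
        by (auto simp: scalar_prod_def atLeast0LessThan mat_adjoint_index[OF P] mult.commute
          intro!: sum.cong)
    qed
    also have "\<dots> = complex_of_real (\<Sum>k<n. (cmod ((X * U) $$ (k, j)))\<^sup>2)"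
      by (simp only: of_real_sum complex_norm_square)
    finally have "d j = (\<Sum>k<n. (cmod ((X * U) $$ (k, j)))\<^sup>2)" by (simp only: of_real_eq_iff)
    then show ?thesis by (simp add: sum_nonneg)
  qed
  moreover have "mat_trace G = complex_of_real (\<Sum>j<n. d j)"
    using mat_trace_mult_common_eigenbasis[OF U GU one_spectral[OF U]] G by simp
  ultimately show ?thesis using that[OF U GU[unfolded G_def]] by (simp add: G_def)
qed

section \<open>Two inequalities for weights between 0 and 1\<close>

text \<open>Row \<open>j\<close> and column \<open>l\<close> overlap only in the cell \<open>(j, l)\<close>, so their sums add up to at most the total
  plus one. Averaging this over \<open>l\<close> with weights \<open>d'\<close> and then over \<open>j\<close> with weights \<open>d\<close> gives the
  claim.\<close>

lemma row_column_average_le: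
  fixes w :: "nat \<Rightarrow> nat \<Rightarrow> real"
  assumes w0: "\<And>j l. j < n \<Longrightarrow> l < n \<Longrightarrow> w j l \<ge> 0" and w1: "\<And>j l. j < n \<Longrightarrow> l < n \<Longrightarrow> w j l \<le> 1"
    and d: "\<And>j. j < n \<Longrightarrow> d j \<ge> 0" "(\<Sum>j<n. d j) = 1"
    and d': "\<And>j. j < n \<Longrightarrow> d' j \<ge> 0" "(\<Sum>j<n. d' j) = 1"
  shows "(\<Sum>j<n. \<Sum>l<n. d j * w j l) + (\<Sum>j<n. \<Sum>l<n. d' l * w j l)
    \<le> (\<Sum>j<n. \<Sum>l<n. w j l) + 1"
proof -
  define s where "s = (\<Sum>j<n. \<Sum>l<n. w j l)"
  define r where "r j = (\<Sum>l<n. w j l)" for j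
  define c where "c l = (\<Sum>j<n. w j l)" for l
  have cross: "r j + c l \<le> s + 1" if jl: "j < n" "l < n" for j l
  proof -
    have "c l - w j l = (\<Sum>i\<in>{..<n} - {j}. w i l)"
      unfolding c_def using jl by (subst sum.remove[of _ j]) auto
    also have "\<dots> \<le> (\<Sum>i\<in>{..<n} - {j}. r i)"
      unfolding r_def using jl w0 by (intro sum_mono member_le_sum) auto
    also have "\<dots> = s - r j"
      unfolding s_def r_def[symmetric] using jl by (subst (2) sum.remove[of _ j]) auto
    finally show ?thesis using w1[OF jl] by simp
  qed
  have avg: "(\<Sum>j<n. p j * f j) \<le> b"
    if "\<And>j. j < n \<Longrightarrow> f j \<le> b" "\<And>j. j < n \<Longrightarrow> p j \<ge> 0" "(\<Sum>j<n. p j) = 1" for p f :: "nat \<Rightarrow> real" and b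
  proof -
    have "(\<Sum>j<n. p j * f j) \<le> (\<Sum>j<n. p j * b)"
      using that by (intro sum_mono mult_left_mono) auto
    also have "\<dots> = b" using that(3) by (simp flip: sum_distrib_right)
    finally show ?thesis .
  qed
  have "(\<Sum>l<n. d' l * c l) \<le> s + 1 - r j" if "j < n" for j
    using cross[OF that] by (intro avg) (auto simp: d' algebra_simps)
  then have "r j \<le> s + 1 - (\<Sum>l<n. d' l * c l)" if "j < n" for j
    using that by (simp add: algebra_simps)
  then have "(\<Sum>j<n. d j * r j) \<le> s + 1 - (\<Sum>l<n. d' l * c l)"
    by (intro avg) (auto simp: d)
  moreover have "(\<Sum>j<n. \<Sum>l<n. d j * w j l) = (\<Sum>j<n. d j * r j)"
    by (simp add: r_def sum_distrib_left)
  moreover have "(\<Sum>j<n. \<Sum>l<n. d' l * w j l) = (\<Sum>l<n. d' l * c l)"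
    by (subst sum.swap) (simp add: c_def sum_distrib_left)
  ultimately show ?thesis by (simp add: s_def)
qed

text \<open>Keep only the pairs with \<open>a j * a l < 0\<close> and apply Cauchy-Schwarz, with \<open>w\<^sup>2 \<le> w\<close>. If \<open>P\<close> and \<open>Q\<close> are
  the sums of the squares of the positive and of the negative \<open>a j\<close>, the squared products over those
  pairs sum to \<open>2 P Q \<le> (P + Q)\<^sup>2 / 2\<close>.\<close>

lemma opposite_sign_sum_le:
  fixes w :: "nat \<Rightarrow> nat \<Rightarrow> real"
  assumes w0: "\<And>j l. j < n \<Longrightarrow> l < n \<Longrightarrow> w j l \<ge> 0" and w1: "\<And>j l. j < n \<Longrightarrow> l < n \<Longrightarrow> w j l \<le> 1"
  shows "- (\<Sum>j<n. \<Sum>l<n. a j * a l * w j l)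
    \<le> sqrt ((\<Sum>j<n. \<Sum>l<n. w j l) / 2) * (\<Sum>j<n. (a j)\<^sup>2)"
proof -
  define S where "S = {..<n} \<times> {..<n}"
  define t where "t = (\<lambda>(j, l). max 0 (- (a j * a l)))"
  define W where "W = (\<lambda>(j, l). w j l)"
  define p where "p j = (max 0 (a j))\<^sup>2" for j
  define q where "q j = (max 0 (- a j))\<^sup>2" for j
  define P where "P = (\<Sum>j<n. p j)"
  define Q where "Q = (\<Sum>j<n. q j)"
  have pq: "(a j)\<^sup>2 = p j + q j" for j by (auto simp: p_def q_def max_def)
  then have PQ: "(\<Sum>j<n. (a j)\<^sup>2) = P + Q" by (simp add: P_def Q_def sum.distrib)
  have PQ0: "P + Q \<ge> 0" by (simp flip: PQ add: sum_nonneg)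
  have t2: "(t (j, l))\<^sup>2 = p j * q l + q j * p l" for j l
    by (cases "a j \<ge> 0"; cases "a l \<ge> 0")
      (auto simp: t_def p_def q_def max_def power_mult_distrib mult_nonneg_nonneg mult_nonpos_nonpos
        mult_le_0_iff zero_le_mult_iff)
  have "(\<Sum>x\<in>S. (t x)\<^sup>2) = (\<Sum>j<n. \<Sum>l<n. (t (j, l))\<^sup>2)"
    by (simp add: S_def sum.cartesian_product)
  also have "\<dots> = 2 * (P * Q)"
    unfolding t2 by (simp add: sum.distrib P_def Q_def flip: sum_product)
  also have "\<dots> \<le> (P + Q)\<^sup>2 / 2"
    using zero_le_power2[of "P - Q"] by (simp add: power2_eq_square algebra_simps)
  finally have T: "(\<Sum>x\<in>S. (t x)\<^sup>2) \<le> (P + Q)\<^sup>2 / 2" .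
  have "(\<Sum>x\<in>S. (W x)\<^sup>2) \<le> (\<Sum>x\<in>S. W x)"
    using w0 w1 by (intro sum_mono) (auto simp: S_def W_def power2_eq_square mult_left_le)
  also have sW: "(\<Sum>x\<in>S. W x) = (\<Sum>j<n. \<Sum>l<n. w j l)"
    by (simp add: S_def W_def sum.cartesian_product)
  finally have W2: "(\<Sum>x\<in>S. (W x)\<^sup>2) \<le> (\<Sum>j<n. \<Sum>l<n. w j l)" .
  have "- (\<Sum>j<n. \<Sum>l<n. a j * a l * w j l) = (\<Sum>x\<in>S. (case x of (j, l) \<Rightarrow> - (a j * a l)) * W x)"
    by (simp add: S_def W_def sum.cartesian_product sum_negf case_prod_beta flip: sum_negf)
  also have "\<dots> \<le> (\<Sum>x\<in>S. t x * W x)"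
    using w0 by (intro sum_mono mult_right_mono) (auto simp: S_def t_def W_def)
  also have "\<dots> \<le> sqrt ((\<Sum>x\<in>S. (t x)\<^sup>2) * (\<Sum>x\<in>S. (W x)\<^sup>2))"
    by (rule real_le_rsqrt[OF Cauchy_Schwarz_ineq_sum])
  also have "\<dots> \<le> sqrt ((P + Q)\<^sup>2 / 2 * (\<Sum>j<n. \<Sum>l<n. w j l))"
    by (intro real_sqrt_le_mono mult_mono T W2 sum_nonneg) auto
  also have "\<dots> = sqrt ((\<Sum>j<n. \<Sum>l<n. w j l) / 2) * (P + Q)"
    using PQ0 by (simp add: real_sqrt_mult real_sqrt_divide)
  finally show ?thesis by (simp add: PQ)
qed

section \<open>The eigenvalue bound\<close>

lemma hermitian_parts:
  fixes X :: "complex mat"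
  assumes X: "X \<in> carrier_mat n n"
  defines "A \<equiv> (1 / 2) \<cdot>\<^sub>m (X + mat_adjoint X)"
    and "B \<equiv> (- \<i> / 2) \<cdot>\<^sub>m (X - mat_adjoint X)"
  shows "A \<in> carrier_mat n n" "B \<in> carrier_mat n n" "mat_adjoint A = A" "mat_adjoint B = B"
proof -
  note X' = mat_adjoint_carrier[OF X]
  show A: "A \<in> carrier_mat n n" and B: "B \<in> carrier_mat n n"
    using X X' by (auto simp: A_def B_def)
  show "mat_adjoint A = A"
  proof (rule eq_matI)
    fix i j assume "i < dim_row A" "j < dim_col A"
    then have ij: "i < n" "j < n" using A by auto
    show "mat_adjoint A $$ (i, j) = A $$ (i, j)"
      unfolding mat_adjoint_index[OF A ij] using ij X X' by (simp add: A_def mat_adjoint_index[OF X])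
  qed (use A mat_adjoint_carrier[OF A] in auto)
  show "mat_adjoint B = B"
  proof (rule eq_matI)
    fix i j assume "i < dim_row B" "j < dim_col B"
    then have ij: "i < n" "j < n" using B by auto
    show "mat_adjoint B $$ (i, j) = B $$ (i, j)"
      unfolding mat_adjoint_index[OF B ij] using ij X X'
      by (simp add: B_def mat_adjoint_index[OF X] algebra_simps)
  qed (use B mat_adjoint_carrier[OF B] in auto)
qed

text \<open>The mixed terms in \<open>A\<close> and \<open>B\<close> cancel when \<open>X = A + \<i> B\<close> and \<open>X\<^sup>* = A - \<i> B\<close> are interchanged
  and the results added.\<close>

lemma sandwich_hermitian_parts:
  assumes X: "X \<in> carrier_mat n n" and Y: "Y \<in> carrier_mat n n"
  defines "A \<equiv> (1 / 2) \<cdot>\<^sub>m (X + mat_adjoint X)"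
    and "B \<equiv> (- \<i> / 2) \<cdot>\<^sub>m (X - mat_adjoint X)"
  shows "sandwich Y X (mat_adjoint X) + sandwich Y (mat_adjoint X) X
    = 2 * (sandwich Y A A + sandwich Y B B)"
proof -
  note X' = mat_adjoint_carrier[OF X] and Y' = mat_adjoint_carrier[OF Y]
  have smult: "sandwich Y (c \<cdot>\<^sub>m P) (c \<cdot>\<^sub>m P) = c * c * sandwich Y P P"
    if P: "P \<in> carrier_mat n n" for c P
  proof -
    have assoc: "c \<cdot>\<^sub>m (c \<cdot>\<^sub>m M) = (c * c) \<cdot>\<^sub>m M" for M :: "complex mat"
      by (rule eq_matI) auto
    have PY: "P * Y \<in> carrier_mat n n" and PYP: "P * Y * P \<in> carrier_mat n n" using P Y by auto
    have "c \<cdot>\<^sub>m P * Y * (c \<cdot>\<^sub>m P) * mat_adjoint Y = (c * c) \<cdot>\<^sub>m (P * Y * P * mat_adjoint Y)"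
      by (simp add: mult_smult_assoc_mat[OF P Y] mult_smult_assoc_mat[OF PY smult_carrier_mat[OF P]]
          mult_smult_distrib[OF PY P] mult_smult_assoc_mat[OF PYP Y'] assoc
          mult_smult_assoc_mat[OF smult_carrier_mat[OF PYP] Y'])
    moreover have "P * Y * P * mat_adjoint Y \<in> carrier_mat n n"
      by (rule mult_carrier_mat[OF PYP Y'])
    ultimately show ?thesis by (simp add: sandwich_def mat_trace_smult)
  qed
  have addl: "sandwich Y (P + P') Q = sandwich Y P Q + sandwich Y P' Q"
    and subl: "sandwich Y (P - P') Q = sandwich Y P Q - sandwich Y P' Q"
    and addr: "sandwich Y Q (P + P') = sandwich Y Q P + sandwich Y Q P'"
    and subr: "sandwich Y Q (P - P') = sandwich Y Q P - sandwich Y Q P'"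
    if P: "P \<in> carrier_mat n n" "P' \<in> carrier_mat n n" and Q: "Q \<in> carrier_mat n n" for P P' Q
    unfolding sandwich_def using P Q Y Y'
    by (simp_all add: add_mult_distrib_mat[of _ n n _ _ n] minus_mult_distrib_mat[of _ n n _ _ n]
        mult_add_distrib_mat[of _ n n _ n] mult_minus_distrib_mat[of _ n n _ n]
        assoc_mult_mat[of _ n n _ n _ n] mat_trace_add[of _ n] mat_trace_minus[of _ n])
  show ?thesis
    unfolding A_def B_def using X X'
    by (simp add: smult addl subl addr subr minus_carrier_mat[of _ n n] algebra_simps)
qed

lemma trace_T_map_eq:
  assumes X: "X \<in> carrier_mat n n" and Y: "Y \<in> carrier_mat n n"
  shows "mat_trace (T_map X Y * mat_adjoint Y)
    = sandwich Y (mat_adjoint X * X) (1\<^sub>m n) + sandwich Y (1\<^sub>m n) (X * mat_adjoint X)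
      - (sandwich Y X (mat_adjoint X) + sandwich Y (mat_adjoint X) X)"
proof -
  note X' = mat_adjoint_carrier[OF X] and Y' = mat_adjoint_carrier[OF Y]
  define a where "a = mat_adjoint X * X * Y"
  define b where "b = mat_adjoint X * Y * X"
  define c where "c = X * Y * mat_adjoint X"
  define d where "d = Y * (X * mat_adjoint X)"
  have car: "a \<in> carrier_mat n n" "b \<in> carrier_mat n n" "c \<in> carrier_mat n n" "d \<in> carrier_mat n n"
    using X Y X' by (auto simp: a_def b_def c_def d_def)
  have "T_map X Y = mat_adjoint X * (X * Y - Y * X) - (X * Y - Y * X) * mat_adjoint X"
    by (simp add: T_map_def commutator_def)
  also have "\<dots> = (a - b) - (c - d)"
    unfolding a_def b_def c_def d_def using X Y X'
    by (simp add: minus_mult_distrib_mat[of _ n n _ _ n] mult_minus_distrib_mat[of _ n n _ n]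
      assoc_mult_mat[of _ n n _ n _ n])
  finally have "T_map X Y * mat_adjoint Y
      = (a * mat_adjoint Y - b * mat_adjoint Y) - (c * mat_adjoint Y - d * mat_adjoint Y)"
    using minus_mult_distrib_mat[OF minus_carrier_mat[OF car(2)] minus_carrier_mat[OF car(4)] Y', of a c]
    by (simp add: minus_mult_distrib_mat[OF car(1,2) Y'] minus_mult_distrib_mat[OF car(3,4) Y'])
  then have "mat_trace (T_map X Y * mat_adjoint Y)
      = mat_trace (a * mat_adjoint Y) - mat_trace (b * mat_adjoint Y)
        - (mat_trace (c * mat_adjoint Y) - mat_trace (d * mat_adjoint Y))"
    using car Y' by (simp add: mat_trace_minus[of _ n] minus_carrier_mat[of _ n n])
  then show ?thesis
    using X Y X' by (simp add: sandwich_def a_def b_def c_def d_def)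
qed

text \<open>The left-hand side is \<open>\<Sum>\<^sub>i \<parallel>[X, Y\<^sub>i]\<parallel>\<^sup>2\<close>.\<close>

theorem orthonormal_commutator_sum_le:
  assumes X: "X \<in> carrier_mat n n" and norm: "mat_trace (X * mat_adjoint X) = 1"
    and Y: "orthonormal_mats n m Y"
  shows "(\<Sum>i<m. Re (mat_trace (T_map X (Y i) * mat_adjoint (Y i)))) \<le> m + 1 + sqrt (2 * m)"
proof -
  note X' = mat_adjoint_carrier[OF X]
  have Yc: "Y i \<in> carrier_mat n n" if "i < m" for i using Y that by (simp add: orthonormal_mats_def)
  define A where "A = (1 / 2) \<cdot>\<^sub>m (X + mat_adjoint X)"
  define B where "B = (- \<i> / 2) \<cdot>\<^sub>m (X - mat_adjoint X)"
  note herm = hermitian_parts[OF X, folded A_def B_def]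
  obtain UA a where UA: "unitary_mat n UA" and Aa: "A = UA * rdiag n a * mat_adjoint UA"
    by (rule hermitian_spectral[OF herm(1,3)])
  obtain UB b where UB: "unitary_mat n UB" and Bb: "B = UB * rdiag n b * mat_adjoint UB"
    by (rule hermitian_spectral[OF herm(2,4)])
  have tr1: "mat_trace (mat_adjoint X * X) = 1"
    using mat_trace_comm[OF X' X] norm by simp
  obtain U d where U: "unitary_mat n U" and Ud: "mat_adjoint X * X = U * rdiag n d * mat_adjoint U"
    and d0: "\<And>j. j < n \<Longrightarrow> d j \<ge> 0" and d1: "mat_trace (mat_adjoint X * X) = complex_of_real (\<Sum>j<n. d j)"
    using gram_spectral[OF X] by blast
  obtain V e where V: "unitary_mat n V" and Ve: "X * mat_adjoint X = V * rdiag n e * mat_adjoint V"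
    and e0: "\<And>j. j < n \<Longrightarrow> e j \<ge> 0" and e1: "mat_trace (X * mat_adjoint X) = complex_of_real (\<Sum>j<n. e j)"
    using gram_spectral[OF X'] unfolding mat_adjoint_adjoint[OF X] by blast
  have d1: "(\<Sum>j<n. d j) = 1" and e1: "(\<Sum>j<n. e j) = 1"
    using d1 e1 unfolding tr1 norm by (metis of_real_eq_1_iff)+
  have gram: "Re (\<Sum>i<m. sandwich (Y i) (mat_adjoint X * X) (1\<^sub>m n))
      + Re (\<Sum>i<m. sandwich (Y i) (1\<^sub>m n) (X * mat_adjoint X)) \<le> m + 1"
  proof -
    \<comment> \<open>decomposing the identity in the basis of the other factor makes both terms use the same weights\<close>
    have "Re (\<Sum>i<m. sandwich (Y i) (mat_adjoint X * X) (1\<^sub>m n)) = (\<Sum>j<n. \<Sum>l<n. d j * weight m Y U V j l)"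
      unfolding sum_sandwich_spectral[OF Y U V Ud one_spectral[OF V]] by simp
    moreover have "Re (\<Sum>i<m. sandwich (Y i) (1\<^sub>m n) (X * mat_adjoint X)) = (\<Sum>j<n. \<Sum>l<n. e l * weight m Y U V j l)"
      unfolding sum_sandwich_spectral[OF Y U V one_spectral[OF U] Ve] by simp
    ultimately show ?thesis
      using row_column_average_le[where w = "weight m Y U V" and n = n and d = d and d' = e,
          OF weight_nonneg weight_le_1[OF Y U V] d0 d1 e0 e1]
      by (simp add: sum_weight[OF Y U V])
  qed
  have herm_le: "- Re (\<Sum>i<m. sandwich (Y i) H H) \<le> sqrt (m / 2) * Re (mat_trace (H * H))"
    if W: "unitary_mat n W" and H: "H = W * rdiag n h * mat_adjoint W" for H W h
  proof -
    have "- Re (\<Sum>i<m. sandwich (Y i) H H) = - (\<Sum>j<n. \<Sum>l<n. h j * h l * weight m Y W W j l)"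
      unfolding sum_sandwich_spectral[OF Y W W H H] by simp
    also have "\<dots> \<le> sqrt (m / 2) * (\<Sum>j<n. (h j)\<^sup>2)"
      using opposite_sign_sum_le[where w = "weight m Y W W" and n = n and a = h,
          OF weight_nonneg weight_le_1[OF Y W W]]
      by (simp add: sum_weight[OF Y W W])
    also have "(\<Sum>j<n. (h j)\<^sup>2) = Re (mat_trace (H * H))"
      unfolding mat_trace_mult_common_eigenbasis[OF W H H] by (simp add: power2_eq_square)
    finally show ?thesis .
  qed
  \<comment> \<open>\<open>\<parallel>A\<parallel>\<^sup>2 + \<parallel>B\<parallel>\<^sup>2 = \<parallel>X\<parallel>\<^sup>2\<close> is the case \<open>Y = 1\<close> of the identity for the Hermitian parts\<close>
  have "sandwich (1\<^sub>m n) X (mat_adjoint X) + sandwich (1\<^sub>m n) (mat_adjoint X) X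
      = 2 * (sandwich (1\<^sub>m n) A A + sandwich (1\<^sub>m n) B B)"
    unfolding A_def B_def by (rule sandwich_hermitian_parts[OF X one_carrier_mat])
  then have "2 * mat_trace (A * A) + 2 * mat_trace (B * B) = 2"
    using X X' herm norm tr1 by (simp add: sandwich_def mat_adjoint_one)
  moreover have "x + y = 1" if "2 * x + 2 * y = 2" for x y :: complex
    using arg_cong[OF that, of "\<lambda>z. z / 2"] by (simp add: add_divide_distrib)
  ultimately have trAB: "mat_trace (A * A) + mat_trace (B * B) = 1" by blast
  have "(\<Sum>i<m. mat_trace (T_map X (Y i) * mat_adjoint (Y i)))
      = (\<Sum>i<m. sandwich (Y i) (mat_adjoint X * X) (1\<^sub>m n)
        + sandwich (Y i) (1\<^sub>m n) (X * mat_adjoint X)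
        - 2 * (sandwich (Y i) A A + sandwich (Y i) B B))"
    by (intro sum.cong refl)
      (simp add: trace_T_map_eq[OF X Yc] sandwich_hermitian_parts[OF X Yc, folded A_def B_def])
  also have "\<dots> = (\<Sum>i<m. sandwich (Y i) (mat_adjoint X * X) (1\<^sub>m n))
        + (\<Sum>i<m. sandwich (Y i) (1\<^sub>m n) (X * mat_adjoint X))
        - 2 * ((\<Sum>i<m. sandwich (Y i) A A) + (\<Sum>i<m. sandwich (Y i) B B))"
    by (simp add: sum.distrib sum_subtractf sum_distrib_left)
  finally have split: "(\<Sum>i<m. Re (mat_trace (T_map X (Y i) * mat_adjoint (Y i))))
      = Re (\<Sum>i<m. sandwich (Y i) (mat_adjoint X * X) (1\<^sub>m n))
        + Re (\<Sum>i<m. sandwich (Y i) (1\<^sub>m n) (X * mat_adjoint X))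
        + 2 * (- Re (\<Sum>i<m. sandwich (Y i) A A) + - Re (\<Sum>i<m. sandwich (Y i) B B))"
    unfolding Re_sum[symmetric] by (simp del: Re_sum)
  also have "\<dots> \<le> (m + 1) + 2 * (sqrt (m / 2) * Re (mat_trace (A * A)) + sqrt (m / 2) * Re (mat_trace (B * B)))"
    by (intro add_mono mult_left_mono gram herm_le[OF UA Aa] herm_le[OF UB Bb]) simp
  also have "\<dots> = (m + 1) + 2 * (sqrt (m / 2) * Re (mat_trace (A * A) + mat_trace (B * B)))"
    by (simp add: algebra_simps)
  also have "\<dots> = m + 1 + 2 * sqrt (m / 2)" unfolding trAB by simp
  also have "2 * sqrt (m / 2) = sqrt (2 * m)"
    using real_sqrt_mult[of 4 "m / 2"] by simp
  finally show ?thesis by simp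
qed

theorem theorem1p4:
  fixes n k :: nat and X :: "complex mat"
  assumes "X \<in> carrier_mat n n"
    and "frobenius_norm X = 1"
    and "1 \<le> k" and "k \<le> n\<^sup>2 div 2"
  shows "(\<Sum>i = 1..2 * k. eig_desc n (T_map X) i) \<le> 2 * real k + 1 + 2 * sqrt (real k)"
proof -
  note X = assms(1)
  have "2 * k \<le> n * n" using assms(4) by (simp add: power2_eq_square)
  then obtain Y where Y: "orthonormal_mats n (2 * k) Y"
    and sum: "(\<Sum>i = 1..2 * k. eig_desc n (T_map X) i)
      = (\<Sum>i<2 * k. Re (mat_trace (T_map X (Y i) * mat_adjoint (Y i))))"
    using eig_desc_sum_attained[OF X] by blast
  have "mat_trace (X * mat_adjoint X) = 1"
    using assms(2) mat_trace_adjoint_square[OF X] by (simp add: frobenius_norm_def)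
  from orthonormal_commutator_sum_le[OF X this Y]
  have "(\<Sum>i = 1..2 * k. eig_desc n (T_map X) i) \<le> 2 * k + 1 + sqrt (4 * k)"
    unfolding sum by simp
  also have "sqrt (4 * k) = 2 * sqrt k" by (simp add: real_sqrt_mult)
  finally show ?thesis by simp
qed

end
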